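(* Let $\mathfrak{g}$ be a Lie algebra over $\mathbb{F}$ such that $\mathfrak{g}=[\mathfrak{g},\mathfrak{g}]$. Let $\mathcal{S}$ be an $m$-dimensional associative and commutative algebra with unit over $\mathbb{F}$, having a non-zero element $s$ such that $s^m=0$ and $s^{m-1}\neq 0$. If the current Lie algebra $\mathfrak{g}\otimes\mathcal{S}$ admits an invariant metric $\bar{B}$, then $\mathfrak{g}$ also admits an invariant metric.
   Context: All algebras and vector spaces are finite-dimensional over a field $\mathbb{F}$ of characteristic zero. An invariant metric on a Lie algebra is a non-degenerate, symmetric bilinear form $B$ with $B(x,[y,z])=B([x,y],z)$ for all $x,y,z$. The current Lie algebra of $\mathfrak{g}$ by $\mathcal{S}$ is $\mathfrak{g}\otimes\mathcal{S}$ with bracket $[x\otimes s,y\otimes t]=[x,y]\otimes st$. *)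

theory Defs
  imports "Jordan_Normal_Form.Missing_VectorSpace" "HOL-Algebra.QuotRing"
begin

section \<open>Lie algebras\<close>

text \<open>
  The \<open>mult\<close> and \<open>one\<close> fields inherited from \<open>module\<close> (a record built on top of
  \<open>ring\<close>) carry no information about the Lie algebra; only \<open>bracket\<close> does.
\<close>

record ('a, 'b) lie_alg = "('a, 'b) module" +
  bracket :: "'b \<Rightarrow> 'b \<Rightarrow> 'b"

locale lie_algebra = vectorspace K L
  for K :: "('a, 'k) ring_scheme" and L :: "('a, 'b, 'l) lie_alg_scheme" +
  assumes bracket_closed:
      "\<lbrakk>x \<in> carrier L; y \<in> carrier L\<rbrakk> \<Longrightarrow> bracket L x y \<in> carrier L"
    and bracket_add_left:
      "\<lbrakk>x \<in> carrier L; y \<in> carrier L; z \<in> carrier L\<rbrakk> \<Longrightarrow>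
        bracket L (x \<oplus>\<^bsub>L\<^esub> y) z = bracket L x z \<oplus>\<^bsub>L\<^esub> bracket L y z"
    and bracket_add_right:
      "\<lbrakk>x \<in> carrier L; y \<in> carrier L; z \<in> carrier L\<rbrakk> \<Longrightarrow>
        bracket L x (y \<oplus>\<^bsub>L\<^esub> z) = bracket L x y \<oplus>\<^bsub>L\<^esub> bracket L x z"
    and bracket_smult_left:
      "\<lbrakk>a \<in> carrier K; x \<in> carrier L; y \<in> carrier L\<rbrakk> \<Longrightarrow>
        bracket L (a \<odot>\<^bsub>L\<^esub> x) y = a \<odot>\<^bsub>L\<^esub> bracket L x y"
    and bracket_smult_right:
      "\<lbrakk>a \<in> carrier K; x \<in> carrier L; y \<in> carrier L\<rbrakk> \<Longrightarrow>
        bracket L x (a \<odot>\<^bsub>L\<^esub> y) = a \<odot>\<^bsub>L\<^esub> bracket L x y"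
    and bracket_self:
      "x \<in> carrier L \<Longrightarrow> bracket L x x = \<zero>\<^bsub>L\<^esub>"
    and jacobi:
      "\<lbrakk>x \<in> carrier L; y \<in> carrier L; z \<in> carrier L\<rbrakk> \<Longrightarrow>
        bracket L x (bracket L y z) \<oplus>\<^bsub>L\<^esub> bracket L y (bracket L z x)
          \<oplus>\<^bsub>L\<^esub> bracket L z (bracket L x y) = \<zero>\<^bsub>L\<^esub>"

text \<open>\<open>[L, L]\<close> is the linear span of all brackets, not merely the set of brackets.\<close>

definition derived_algebra :: "('a, 'k) ring_scheme \<Rightarrow> ('a, 'b, 'l) lie_alg_scheme \<Rightarrow> 'b set"
  where "derived_algebra K L =
    LinearCombinations.module.span K L {bracket L x y | x y. x \<in> carrier L \<and> y \<in> carrier L}"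

definition bilinear_form ::
    "('a, 'k) ring_scheme \<Rightarrow> ('a, 'b, 'm) module_scheme \<Rightarrow> ('b \<Rightarrow> 'b \<Rightarrow> 'a) \<Rightarrow> bool"
  where "bilinear_form K V B \<longleftrightarrow>
    (\<forall>x\<in>carrier V. \<forall>y\<in>carrier V. B x y \<in> carrier K) \<and>
    (\<forall>x\<in>carrier V. \<forall>y\<in>carrier V. \<forall>z\<in>carrier V.
        B (x \<oplus>\<^bsub>V\<^esub> y) z = B x z \<oplus>\<^bsub>K\<^esub> B y z \<and> B x (y \<oplus>\<^bsub>V\<^esub> z) = B x y \<oplus>\<^bsub>K\<^esub> B x z) \<and>
    (\<forall>a\<in>carrier K. \<forall>x\<in>carrier V. \<forall>y\<in>carrier V.
        B (a \<odot>\<^bsub>V\<^esub> x) y = a \<otimes>\<^bsub>K\<^esub> B x y \<and> B x (a \<odot>\<^bsub>V\<^esub> y) = a \<otimes>\<^bsub>K\<^esub> B x y)"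

definition invariant_metric ::
    "('a, 'k) ring_scheme \<Rightarrow> ('a, 'b, 'l) lie_alg_scheme \<Rightarrow> ('b \<Rightarrow> 'b \<Rightarrow> 'a) \<Rightarrow> bool"
  where "invariant_metric K L B \<longleftrightarrow>
    bilinear_form K L B \<and>
    (\<forall>x\<in>carrier L. \<forall>y\<in>carrier L. B x y = B y x) \<and>
    (\<forall>x\<in>carrier L. (\<forall>y\<in>carrier L. B x y = \<zero>\<^bsub>K\<^esub>) \<longrightarrow> x = \<zero>\<^bsub>L\<^esub>) \<and>
    (\<forall>x\<in>carrier L. \<forall>y\<in>carrier L. \<forall>z\<in>carrier L.
        B x (bracket L y z) = B (bracket L x y) z)"


section \<open>Tensor products\<close>

text \<open>
  The tensor product of \<open>V\<close> and \<open>W\<close> is the free vector space on the set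
  \<open>carrier V \<times> carrier W\<close> modulo the subspace spanned by the bilinearity relations.
  Its elements are therefore cosets of finitely supported \<open>K\<close>-valued functions on
  \<open>carrier V \<times> carrier W\<close>; the pure tensor of \<open>v\<close> and \<open>w\<close> is the coset of
  \<open>tensor_gen K V W v w\<close>.
\<close>

definition free_module :: "('a, 'k) ring_scheme \<Rightarrow> 'i set \<Rightarrow> ('a, 'i \<Rightarrow> 'a) module"
  where "free_module K I = (ring.func_space K I)
    \<lparr>carrier := {f \<in> I \<rightarrow>\<^sub>E carrier K. finite {i \<in> I. f i \<noteq> \<zero>\<^bsub>K\<^esub>}}\<rparr>"

definition free_gen :: "('a, 'k) ring_scheme \<Rightarrow> 'i set \<Rightarrow> 'i \<Rightarrow> ('i \<Rightarrow> 'a)"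
  where "free_gen K I i = (\<lambda>j\<in>I. if j = i then \<one>\<^bsub>K\<^esub> else \<zero>\<^bsub>K\<^esub>)"

text \<open>
  As in \<^const>\<open>rcoset_mult\<close>, the scalar multiple of a coset is given as a union over all
  representatives; taking the image of the coset under scalar multiplication
  instead would be wrong for the scalar zero.
\<close>

definition quotient_module ::
    "('a, 'b, 'm) module_scheme \<Rightarrow> 'b set \<Rightarrow> ('a, 'b set) module"
  where "quotient_module M N =
    \<lparr>carrier = a_rcosets\<^bsub>M\<^esub> N, mult = rcoset_mult M N, one = (N +>\<^bsub>M\<^esub> \<one>\<^bsub>M\<^esub>),
     zero = N, add = set_add M, smult = (\<lambda>a X. \<Union>x\<in>X. N +>\<^bsub>M\<^esub> (a \<odot>\<^bsub>M\<^esub> x))\<rparr>"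

definition tensor_free ::
    "('a, 'k) ring_scheme \<Rightarrow> ('a, 'v, 'm) module_scheme \<Rightarrow> ('a, 'w, 'n) module_scheme
      \<Rightarrow> ('a, 'v \<times> 'w \<Rightarrow> 'a) module"
  where "tensor_free K V W = free_module K (carrier V \<times> carrier W)"

definition tensor_gen ::
    "('a, 'k) ring_scheme \<Rightarrow> ('a, 'v, 'm) module_scheme \<Rightarrow> ('a, 'w, 'n) module_scheme
      \<Rightarrow> 'v \<Rightarrow> 'w \<Rightarrow> ('v \<times> 'w \<Rightarrow> 'a)"
  where "tensor_gen K V W v w = free_gen K (carrier V \<times> carrier W) (v, w)"

definition tensor_relations ::
    "('a, 'k) ring_scheme \<Rightarrow> ('a, 'v, 'm) module_scheme \<Rightarrow> ('a, 'w, 'n) module_scheme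
      \<Rightarrow> ('v \<times> 'w \<Rightarrow> 'a) set"
  where "tensor_relations K V W =
    (let F = tensor_free K V W; e = tensor_gen K V W in
      {e (v \<oplus>\<^bsub>V\<^esub> v') w \<ominus>\<^bsub>F\<^esub> (e v w \<oplus>\<^bsub>F\<^esub> e v' w) | v v' w.
          v \<in> carrier V \<and> v' \<in> carrier V \<and> w \<in> carrier W} \<union>
      {e v (w \<oplus>\<^bsub>W\<^esub> w') \<ominus>\<^bsub>F\<^esub> (e v w \<oplus>\<^bsub>F\<^esub> e v w') | v w w'.
          v \<in> carrier V \<and> w \<in> carrier W \<and> w' \<in> carrier W} \<union>
      {e (a \<odot>\<^bsub>V\<^esub> v) w \<ominus>\<^bsub>F\<^esub> (a \<odot>\<^bsub>F\<^esub> e v w) | a v w.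
          a \<in> carrier K \<and> v \<in> carrier V \<and> w \<in> carrier W} \<union>
      {e v (a \<odot>\<^bsub>W\<^esub> w) \<ominus>\<^bsub>F\<^esub> (a \<odot>\<^bsub>F\<^esub> e v w) | a v w.
          a \<in> carrier K \<and> v \<in> carrier V \<and> w \<in> carrier W})"

definition tensor_null ::
    "('a, 'k) ring_scheme \<Rightarrow> ('a, 'v, 'm) module_scheme \<Rightarrow> ('a, 'w, 'n) module_scheme
      \<Rightarrow> ('v \<times> 'w \<Rightarrow> 'a) set"
  where "tensor_null K V W =
    LinearCombinations.module.span K (tensor_free K V W) (tensor_relations K V W)"

definition tensor_product ::
    "('a, 'k) ring_scheme \<Rightarrow> ('a, 'v, 'm) module_scheme \<Rightarrow> ('a, 'w, 'n) module_scheme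
      \<Rightarrow> ('a, ('v \<times> 'w \<Rightarrow> 'a) set) module"
  where "tensor_product K V W = quotient_module (tensor_free K V W) (tensor_null K V W)"


section \<open>Current Lie algebras\<close>

text \<open>
  The bilinear map on the free vector space that sends a pair of generators
  \<open>(x, s)\<close>, \<open>(y, t)\<close> to the generator \<open>([x, y], s t)\<close>.
\<close>

definition current_bracket_free ::
    "('a, 'k) ring_scheme \<Rightarrow> ('a, 'g, 'l) lie_alg_scheme \<Rightarrow> ('a, 's, 'n) module_scheme
      \<Rightarrow> ('g \<times> 's \<Rightarrow> 'a) \<Rightarrow> ('g \<times> 's \<Rightarrow> 'a) \<Rightarrow> ('g \<times> 's \<Rightarrow> 'a)"
  where "current_bracket_free K L S f g =
    (let supp = (\<lambda>h. {p \<in> carrier L \<times> carrier S. h p \<noteq> \<zero>\<^bsub>K\<^esub>}) in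
      (\<Oplus>\<^bsub>tensor_free K L S\<^esub> p\<in>supp f. \<Oplus>\<^bsub>tensor_free K L S\<^esub> q\<in>supp g.
        (f p \<otimes>\<^bsub>K\<^esub> g q) \<odot>\<^bsub>tensor_free K L S\<^esub>
          tensor_gen K L S (bracket L (fst p) (fst q)) (snd p \<otimes>\<^bsub>S\<^esub> snd q)))"

text \<open>
  The bracket above respects \<open>tensor_null\<close> in both arguments, so the union over
  representatives below is again a single coset, and the bracket of the pure tensors of
  \<open>x, s\<close> and \<open>y, t\<close> is the pure tensor of \<open>[x, y]\<close> and \<open>s t\<close>.
\<close>

definition current_lie_algebra ::
    "('a, 'k) ring_scheme \<Rightarrow> ('a, 'g, 'l) lie_alg_scheme \<Rightarrow> ('a, 's, 'n) module_scheme
      \<Rightarrow> ('a, ('g \<times> 's \<Rightarrow> 'a) set) lie_alg"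
  where "current_lie_algebra K L S = module.extend (tensor_product K L S)
    (lie_alg.fields (\<lambda>X Y. \<Union>f\<in>X. \<Union>g\<in>Y.
        tensor_null K L S +>\<^bsub>tensor_free K L S\<^esub> current_bracket_free K L S f g))"

end

theory Submission
  imports Defs
begin

text \<open>
  Put \<open>u = s\<^sup>m\<^sup>-\<^sup>1\<close> and \<open>B(x, y) = Bbar(x \<otimes> 1, y \<otimes> u)\<close>. Invariance of \<open>Bbar\<close> together with
  \<open>[L, L] = L\<close> gives \<open>Bbar(x \<otimes> a, y \<otimes> b) = Bbar(x \<otimes> 1, y \<otimes> ab)\<close>, which makes \<open>B\<close> symmetric. The powers
  \<open>1, s, \<dots>, s\<^sup>m\<^sup>-\<^sup>1\<close> form a basis of \<open>S\<close>, so \<open>u t\<close> is a multiple of \<open>u\<close> for every \<open>t\<close>. Hence if \<open>x\<close> lies in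
  the radical of \<open>B\<close>, then \<open>x \<otimes> u\<close> lies in the radical of \<open>Bbar\<close> and vanishes; applying a functional
  \<open>\<phi>\<close> with \<open>\<phi>(u) = 1\<close> to the second factor gives \<open>x = 0\<close>.
\<close>

section \<open>Free modules\<close>

text \<open>The linear extension of \<open>h\<close> from the generators to the free module. The sum
  runs over the support because \<open>I\<close> may be infinite, and \<open>finsum\<close> over an
  infinite set has the default value zero.\<close>

definition free_ext ::
    "('a, 'k) ring_scheme \<Rightarrow> ('a, 'b, 'm) module_scheme \<Rightarrow> 'i set \<Rightarrow> ('i \<Rightarrow> 'b) \<Rightarrow> ('i \<Rightarrow> 'a) \<Rightarrow> 'b"
  where "free_ext K M I h f = (\<Oplus>\<^bsub>M\<^esub> p\<in>{p \<in> I. f p \<noteq> \<zero>\<^bsub>K\<^esub>}. f p \<odot>\<^bsub>M\<^esub> h p)"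

lemma submodule_by_closure:
  assumes "module K M" "N \<subseteq> carrier M" "\<zero>\<^bsub>M\<^esub> \<in> N"
    "\<And>x y. x \<in> N \<Longrightarrow> y \<in> N \<Longrightarrow> x \<oplus>\<^bsub>M\<^esub> y \<in> N"
    "\<And>a x. a \<in> carrier K \<Longrightarrow> x \<in> N \<Longrightarrow> a \<odot>\<^bsub>M\<^esub> x \<in> N"
  shows "submodule K N M"
  using assms by (simp add: submodule_def)

text \<open>The elements satisfying \<open>P\<close> form a submodule containing \<open>A\<close>,
  and the span is the least such submodule.\<close>

lemma (in module) span_induct [consumes 2, case_names zero gen add smult]:
  assumes "x \<in> span A" "A \<subseteq> carrier M" "P \<zero>\<^bsub>M\<^esub>" "\<And>x. x \<in> A \<Longrightarrow> P x"
    "\<And>x y. x \<in> carrier M \<Longrightarrow> y \<in> carrier M \<Longrightarrow> P x \<Longrightarrow> P y \<Longrightarrow> P (x \<oplus>\<^bsub>M\<^esub> y)"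
    "\<And>a x. a \<in> carrier R \<Longrightarrow> x \<in> carrier M \<Longrightarrow> P x \<Longrightarrow> P (a \<odot>\<^bsub>M\<^esub> x)"
  shows "P x"
proof -
  have "submodule R {x \<in> carrier M. P x} M"
    by (rule submodule_by_closure) (use assms module_axioms in auto)
  then have "span A \<subseteq> {x \<in> carrier M. P x}"
    by (rule span_is_subset[rotated]) (use assms in auto)
  with assms(1) show ?thesis by auto
qed

section \<open>The free module on a set and induction over its generators\<close>

context cring
begin

lemma free_module_simps:
  "carrier (free_module R I) = {f \<in> I \<rightarrow>\<^sub>E carrier R. finite {i \<in> I. f i \<noteq> \<zero>}}"
  "\<zero>\<^bsub>free_module R I\<^esub> = (\<lambda>i\<in>I. \<zero>)"
  "f \<oplus>\<^bsub>free_module R I\<^esub> g = (\<lambda>i\<in>I. f i \<oplus> g i)"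
  "a \<odot>\<^bsub>free_module R I\<^esub> f = (\<lambda>i\<in>I. a \<otimes> f i)"
  by (simp_all add: free_module_def func_space_def)

text \<open>Finitely supported functions form a submodule of all functions: the support of a sum
  lies in the union of the supports, and scaling does not enlarge a support.\<close>

lemma free_module_is_module: "module R (free_module R I)"
proof -
  interpret FS: module R "func_space I" by (rule func_space_is_module)
  let ?C = "{f \<in> I \<rightarrow>\<^sub>E carrier R. finite {i \<in> I. f i \<noteq> \<zero>}}"
  have "submodule R ?C (func_space I)"
  proof (rule submodule_by_closure[OF func_space_is_module])
    show "?C \<subseteq> carrier (func_space I)" "\<zero>\<^bsub>func_space I\<^esub> \<in> ?C"
      by (auto simp: func_space_def)
  next
    fix f g assume *: "f \<in> ?C" "g \<in> ?C"
    have "finite {i \<in> I. f i \<oplus> g i \<noteq> \<zero>}"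
      by (rule finite_subset[of _ "{i \<in> I. f i \<noteq> \<zero>} \<union> {i \<in> I. g i \<noteq> \<zero>}"]) (use * in auto)
    then show "f \<oplus>\<^bsub>func_space I\<^esub> g \<in> ?C"
      using * by (auto simp add: func_space_def PiE_def Pi_def extensional_def cong: conj_cong)
  next
    fix a f assume *: "a \<in> carrier R" "f \<in> ?C"
    have "finite {i \<in> I. a \<otimes> f i \<noteq> \<zero>}"
      by (rule finite_subset[of _ "{i \<in> I. f i \<noteq> \<zero>}"]) (use * in auto)
    then show "a \<odot>\<^bsub>func_space I\<^esub> f \<in> ?C"
      using * by (auto simp add: func_space_def PiE_def Pi_def extensional_def cong: conj_cong)
  qed
  from FS.submodule_is_module[OF this] show ?thesis by (simp add: free_module_def)
qed

lemma free_module_coeff_closed: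
  "f \<in> carrier (free_module R I) \<Longrightarrow> i \<in> I \<Longrightarrow> f i \<in> carrier R"
  by (auto simp: free_module_simps)

lemma free_module_finite_support:
  "f \<in> carrier (free_module R I) \<Longrightarrow> finite {i \<in> I. f i \<noteq> \<zero>}"
  by (simp add: free_module_simps)

lemma free_gen_closed: "i \<in> I \<Longrightarrow> free_gen R I i \<in> carrier (free_module R I)"
  by (auto simp: free_module_simps free_gen_def)

text \<open>Induction on the finite support: each step splits off one multiple of a generator, until
  the zero function remains.\<close>

lemma free_module_induct [consumes 1, case_names zero gen add smult]:
  assumes "f \<in> carrier (free_module R I)" "P \<zero>\<^bsub>free_module R I\<^esub>"
    "\<And>i. i \<in> I \<Longrightarrow> P (free_gen R I i)"
    "\<And>f g. f \<in> carrier (free_module R I) \<Longrightarrow> g \<in> carrier (free_module R I) \<Longrightarrow>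
      P f \<Longrightarrow> P g \<Longrightarrow> P (f \<oplus>\<^bsub>free_module R I\<^esub> g)"
    "\<And>a f. a \<in> carrier R \<Longrightarrow> f \<in> carrier (free_module R I) \<Longrightarrow> P f \<Longrightarrow>
      P (a \<odot>\<^bsub>free_module R I\<^esub> f)"
  shows "P f"
proof -
  interpret F: module R "free_module R I" by (rule free_module_is_module)
  have "finite T \<Longrightarrow> f \<in> carrier (free_module R I) \<Longrightarrow> {i \<in> I. f i \<noteq> \<zero>} = T \<Longrightarrow> P f" for T
  proof (induction T arbitrary: f rule: finite_induct)
    case empty
    then have "f = \<zero>\<^bsub>free_module R I\<^esub>"
      by (auto simp: free_module_simps PiE_def extensional_def fun_eq_iff restrict_def)
    then show ?case using assms(2) by simp
  next
    case (insert i T)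
    then have i: "i \<in> I" and f: "f \<in> I \<rightarrow>\<^sub>E carrier R" and fi: "f i \<in> carrier R"
      by (auto simp: free_module_simps)
    \<comment> \<open>Erasing the coefficient at \<open>i\<close> leaves exactly the support
      \<open>T\<close>, so the induction hypothesis applies to \<open>?g\<close>.\<close>
    let ?g = "f(i := \<zero>)"
    have supp: "{j \<in> I. ?g j \<noteq> \<zero>} = T" using insert by auto
    have "finite {j \<in> I. ?g j \<noteq> \<zero>}" unfolding supp by fact
    moreover have "?g \<in> I \<rightarrow>\<^sub>E carrier R" using f i by (simp add: PiE_def Pi_def extensional_def)
    ultimately have g: "?g \<in> carrier (free_module R I)"
      by (simp only: free_module_simps mem_Collect_eq)
    have "f = f i \<odot>\<^bsub>free_module R I\<^esub> free_gen R I i \<oplus>\<^bsub>free_module R I\<^esub> ?g"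
    proof
      show "f j = (f i \<odot>\<^bsub>free_module R I\<^esub> free_gen R I i \<oplus>\<^bsub>free_module R I\<^esub> ?g) j" for j
        using i fi PiE_arb[OF f] PiE_mem[OF f]
        by (cases "j \<in> I"; cases "j = i") (simp_all add: free_module_simps free_gen_def)
    qed
    moreover have "P ?g" using insert.IH[OF g supp] .
    ultimately show ?case
      using assms(4)[OF F.smult_closed[OF fi free_gen_closed[OF i]] g
          assms(5)[OF fi free_gen_closed[OF i] assms(3)[OF i]]]
      by (simp del: fun_upd_apply)
  qed
  with assms(1) show ?thesis by (auto simp: free_module_simps)
qed

end

section \<open>Linear extension of a map from the generators\<close>

context module
begin

text \<open>Indices outside the support contribute zero. Enlarging the index set lets functions with
  different supports be summed over one common finite set.\<close>

lemma free_ext_superset: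
  assumes f: "f \<in> carrier (free_module R I)" and h: "h \<in> I \<rightarrow> carrier M"
    and T: "finite T" "{i \<in> I. f i \<noteq> \<zero>} \<subseteq> T" "T \<subseteq> I"
  shows "free_ext R M I h f = (\<Oplus>\<^bsub>M\<^esub> i\<in>T. f i \<odot>\<^bsub>M\<^esub> h i)"
  unfolding free_ext_def
proof (rule M.add.finprod_mono_neutral_cong_left)
  note f' = free_module_coeff_closed[OF f] and h' = h[THEN funcset_mem]
  show "(\<lambda>i. f i \<odot>\<^bsub>M\<^esub> h i) \<in> T \<rightarrow> carrier M"
    using T(3) by (auto simp: f' h' subset_iff)
  show "f i \<odot>\<^bsub>M\<^esub> h i = \<zero>\<^bsub>M\<^esub>" if "i \<in> T - {i \<in> I. f i \<noteq> \<zero>}" for i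
    using that T(3) h' by auto
qed (use T in auto)

lemma free_ext_closed:
  assumes f: "f \<in> carrier (free_module R I)" and h: "h \<in> I \<rightarrow> carrier M"
  shows "free_ext R M I h f \<in> carrier M"
  unfolding free_ext_def
  by (rule M.finsum_closed) (auto simp: free_module_coeff_closed[OF f] h[THEN funcset_mem])

lemma free_ext_module_hom:
  assumes h: "h \<in> I \<rightarrow> carrier M"
  shows "free_ext R M I h \<in> module_hom R (free_module R I) M"
proof -
  interpret F: module R "free_module R I" by (rule free_module_is_module)
  note h' = h[THEN funcset_mem]
  have "free_ext R M I h (f \<oplus>\<^bsub>free_module R I\<^esub> g) = free_ext R M I h f \<oplus>\<^bsub>M\<^esub> free_ext R M I h g"
    if f: "f \<in> carrier (free_module R I)" and g: "g \<in> carrier (free_module R I)" for f g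
  proof -
    note f' = free_module_coeff_closed[OF f] and g' = free_module_coeff_closed[OF g]
    \<comment> \<open>Cancellation may make the support of the sum smaller than this union, so all
      three sums are taken over the union.\<close>
    let ?T = "{i \<in> I. f i \<noteq> \<zero>} \<union> {i \<in> I. g i \<noteq> \<zero>}"
    have T: "finite ?T" using f g by (simp add: free_module_finite_support)
    have s: "{i \<in> I. (f \<oplus>\<^bsub>free_module R I\<^esub> g) i \<noteq> \<zero>} \<subseteq> ?T" by (auto simp: free_module_simps)
    have sub: "?T \<subseteq> I" by auto
    have "free_ext R M I h (f \<oplus>\<^bsub>free_module R I\<^esub> g)
        = (\<Oplus>\<^bsub>M\<^esub> i\<in>?T. f i \<odot>\<^bsub>M\<^esub> h i \<oplus>\<^bsub>M\<^esub> g i \<odot>\<^bsub>M\<^esub> h i)"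
      unfolding free_ext_superset[OF F.a_closed[OF f g] h T s sub]
      by (rule M.finsum_cong') (auto simp: free_module_simps f' g' h' smult_l_distr)
    also have "\<dots> = (\<Oplus>\<^bsub>M\<^esub> i\<in>?T. f i \<odot>\<^bsub>M\<^esub> h i) \<oplus>\<^bsub>M\<^esub> (\<Oplus>\<^bsub>M\<^esub> i\<in>?T. g i \<odot>\<^bsub>M\<^esub> h i)"
      by (rule M.finsum_addf) (auto simp: f' g' h')
    finally show ?thesis
      using free_ext_superset[OF f h T _ sub] free_ext_superset[OF g h T _ sub] by auto
  qed
  moreover have "free_ext R M I h (a \<odot>\<^bsub>free_module R I\<^esub> f) = a \<odot>\<^bsub>M\<^esub> free_ext R M I h f"
    if a: "a \<in> carrier R" and f: "f \<in> carrier (free_module R I)" for a f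
  proof -
    note f' = free_module_coeff_closed[OF f]
    let ?T = "{i \<in> I. f i \<noteq> \<zero>}"
    have T: "finite ?T" using f by (rule free_module_finite_support)
    have s: "{i \<in> I. (a \<odot>\<^bsub>free_module R I\<^esub> f) i \<noteq> \<zero>} \<subseteq> ?T"
      using a by (auto simp: free_module_simps)
    have "free_ext R M I h (a \<odot>\<^bsub>free_module R I\<^esub> f) = (\<Oplus>\<^bsub>M\<^esub> i\<in>?T. a \<odot>\<^bsub>M\<^esub> (f i \<odot>\<^bsub>M\<^esub> h i))"
      unfolding free_ext_superset[OF F.smult_closed[OF a f] h T s Collect_restrict]
      by (rule M.finsum_cong') (auto simp: free_module_simps a f' h' smult_assoc1)
    also have "\<dots> = a \<odot>\<^bsub>M\<^esub> free_ext R M I h f" unfolding free_ext_def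
      by (rule finsum_smult_ldistr[symmetric]) (use T in \<open>auto simp: a f' h'\<close>)
    finally show ?thesis .
  qed
  ultimately show ?thesis
    using free_ext_closed[OF _ h] by (auto simp: module_hom_def)
qed

lemmas free_ext_add = module_hom_add[OF free_ext_module_hom]
lemmas free_ext_smult = module_hom_smult[OF free_ext_module_hom]

lemma free_ext_free_gen:
  assumes "i \<in> I" "h \<in> I \<rightarrow> carrier M"
  shows "free_ext R M I h (free_gen R I i) = h i"
proof -
  have "free_ext R M I h (free_gen R I i) = (\<Oplus>\<^bsub>M\<^esub> j\<in>{i}. free_gen R I i j \<odot>\<^bsub>M\<^esub> h j)"
    by (rule free_ext_superset) (use assms free_gen_closed in \<open>auto simp: free_gen_def\<close>)
  also have "\<dots> = h i"
    using assms funcset_mem[OF assms(2,1)] by (subst M.finsum_insert) (auto simp: free_gen_def)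
  finally show ?thesis .
qed

text \<open>Linearity in the extended function instead of the argument. The current bracket is a
  nested extension whose second argument enters through that function.\<close>

lemma free_ext_add_fun:
  assumes f: "f \<in> carrier (free_module R I)" and h: "h \<in> I \<rightarrow> carrier M" "h' \<in> I \<rightarrow> carrier M"
  shows "free_ext R M I (\<lambda>i. h i \<oplus>\<^bsub>M\<^esub> h' i) f = free_ext R M I h f \<oplus>\<^bsub>M\<^esub> free_ext R M I h' f"
proof -
  note f' = free_module_coeff_closed[OF f] and h' = h[THEN funcset_mem]
  have "free_ext R M I (\<lambda>i. h i \<oplus>\<^bsub>M\<^esub> h' i) f
      = (\<Oplus>\<^bsub>M\<^esub> i\<in>{i \<in> I. f i \<noteq> \<zero>}. f i \<odot>\<^bsub>M\<^esub> h i \<oplus>\<^bsub>M\<^esub> f i \<odot>\<^bsub>M\<^esub> h' i)"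
    unfolding free_ext_def by (rule M.finsum_cong') (auto simp: f' h' smult_r_distr)
  also have "\<dots> = free_ext R M I h f \<oplus>\<^bsub>M\<^esub> free_ext R M I h' f"
    unfolding free_ext_def by (rule M.finsum_addf) (auto simp: f' h')
  finally show ?thesis .
qed

lemma free_ext_smult_fun:
  assumes f: "f \<in> carrier (free_module R I)" and h: "h \<in> I \<rightarrow> carrier M" and a: "a \<in> carrier R"
  shows "free_ext R M I (\<lambda>i. a \<odot>\<^bsub>M\<^esub> h i) f = a \<odot>\<^bsub>M\<^esub> free_ext R M I h f"
proof -
  note f' = free_module_coeff_closed[OF f] and h' = h[THEN funcset_mem]
  have "f i \<odot>\<^bsub>M\<^esub> (a \<odot>\<^bsub>M\<^esub> h i) = a \<odot>\<^bsub>M\<^esub> (f i \<odot>\<^bsub>M\<^esub> h i)" if "i \<in> I" for i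
    using that a f'[OF that] h'[OF that] by (simp add: smult_assoc1[symmetric] R.m_comm)
  then have "free_ext R M I (\<lambda>i. a \<odot>\<^bsub>M\<^esub> h i) f
      = (\<Oplus>\<^bsub>M\<^esub> i\<in>{i \<in> I. f i \<noteq> \<zero>}. a \<odot>\<^bsub>M\<^esub> (f i \<odot>\<^bsub>M\<^esub> h i))"
    unfolding free_ext_def by (intro M.finsum_cong') (auto simp: a f' h')
  also have "\<dots> = a \<odot>\<^bsub>M\<^esub> free_ext R M I h f"
    unfolding free_ext_def
    by (rule finsum_smult_ldistr[symmetric])
      (auto simp: a f' h' free_module_finite_support[OF f])
  finally show ?thesis .
qed

lemma free_ext_cong:
  assumes f: "f \<in> carrier (free_module R I)" and h': "h' \<in> I \<rightarrow> carrier M"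
    and eq: "\<And>i. i \<in> I \<Longrightarrow> h i = h' i"
  shows "free_ext R M I h f = free_ext R M I h' f"
  unfolding free_ext_def
  by (rule M.finsum_cong') (use free_module_coeff_closed[OF f] h' eq in auto)

end

section \<open>Tensor products\<close>

locale tensor_modules = V: module K V + W: module K W
  for K :: "('a, 'k) ring_scheme" (structure)
    and V :: "('a, 'v, 'm) module_scheme" and W :: "('a, 'w, 'n) module_scheme"
begin

abbreviation "F \<equiv> tensor_free K V W"
abbreviation "N \<equiv> tensor_null K V W"
abbreviation "e \<equiv> tensor_gen K V W"

sublocale F: module K "tensor_free K V W"
  unfolding tensor_free_def by (rule V.R.free_module_is_module)

lemma tensor_gen_closed:
  "v \<in> carrier V \<Longrightarrow> w \<in> carrier W \<Longrightarrow> e v w \<in> carrier F"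
  unfolding tensor_gen_def tensor_free_def by (rule V.R.free_gen_closed) simp

lemma tensor_free_induct [consumes 1, case_names zero gen add smult]:
  assumes "f \<in> carrier F" "P \<zero>\<^bsub>F\<^esub>"
    "\<And>v w. v \<in> carrier V \<Longrightarrow> w \<in> carrier W \<Longrightarrow> P (e v w)"
    "\<And>f g. f \<in> carrier F \<Longrightarrow> g \<in> carrier F \<Longrightarrow> P f \<Longrightarrow> P g \<Longrightarrow> P (f \<oplus>\<^bsub>F\<^esub> g)"
    "\<And>a f. a \<in> carrier K \<Longrightarrow> f \<in> carrier F \<Longrightarrow> P f \<Longrightarrow> P (a \<odot>\<^bsub>F\<^esub> f)"
  shows "P f"
  using assms unfolding tensor_gen_def tensor_free_def
  by - (rule V.R.free_module_induct[of f _ P], auto)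

section \<open>The subspace spanned by the bilinearity relations\<close>

lemma tensor_relations_closed: "tensor_relations K V W \<subseteq> carrier F"
  by (auto simp: tensor_relations_def Let_def tensor_gen_closed)

lemma tensor_null_submodule: "submodule K N F"
  unfolding tensor_null_def
  by (rule F.span_is_submodule[OF tensor_relations_closed])

lemma tensor_null_closed: "f \<in> N \<Longrightarrow> f \<in> carrier F"
  using submodule.subset[OF tensor_null_submodule] by auto

lemma
  shows tensor_null_zero: "\<zero>\<^bsub>F\<^esub> \<in> N"
    and tensor_null_add: "f \<in> N \<Longrightarrow> g \<in> N \<Longrightarrow> f \<oplus>\<^bsub>F\<^esub> g \<in> N"
    and tensor_null_smult: "a \<in> carrier K \<Longrightarrow> f \<in> N \<Longrightarrow> a \<odot>\<^bsub>F\<^esub> f \<in> N"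
  using tensor_null_submodule by (auto simp: submodule_def)

lemma tensor_null_minus: "f \<in> N \<Longrightarrow> \<ominus>\<^bsub>F\<^esub> f \<in> N"
  using tensor_null_smult[of "\<ominus> \<one>" f] by (simp add: F.smult_minus_1 tensor_null_closed)

lemma relations_subset_null: "tensor_relations K V W \<subseteq> N"
  unfolding tensor_null_def by (rule F.in_own_span[OF tensor_relations_closed])

lemma
  shows tensor_gen_add_left:
      "\<lbrakk>v \<in> carrier V; v' \<in> carrier V; w \<in> carrier W\<rbrakk> \<Longrightarrow>
        e (v \<oplus>\<^bsub>V\<^esub> v') w \<ominus>\<^bsub>F\<^esub> (e v w \<oplus>\<^bsub>F\<^esub> e v' w) \<in> N"
    and tensor_gen_add_right:
      "\<lbrakk>v \<in> carrier V; w \<in> carrier W; w' \<in> carrier W\<rbrakk> \<Longrightarrow>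
        e v (w \<oplus>\<^bsub>W\<^esub> w') \<ominus>\<^bsub>F\<^esub> (e v w \<oplus>\<^bsub>F\<^esub> e v w') \<in> N"
    and tensor_gen_smult_left:
      "\<lbrakk>a \<in> carrier K; v \<in> carrier V; w \<in> carrier W\<rbrakk> \<Longrightarrow>
        e (a \<odot>\<^bsub>V\<^esub> v) w \<ominus>\<^bsub>F\<^esub> (a \<odot>\<^bsub>F\<^esub> e v w) \<in> N"
    and tensor_gen_smult_right:
      "\<lbrakk>a \<in> carrier K; v \<in> carrier V; w \<in> carrier W\<rbrakk> \<Longrightarrow>
        e v (a \<odot>\<^bsub>W\<^esub> w) \<ominus>\<^bsub>F\<^esub> (a \<odot>\<^bsub>F\<^esub> e v w) \<in> N"
  by (rule subsetD[OF relations_subset_null], unfold tensor_relations_def Let_def, blast)+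

text \<open>The universal property of the tensor product, for maps that are bilinear modulo \<open>P\<close>.\<close>

lemma free_ext_null:
  assumes "module K M" and P: "submodule K P M"
    and h: "h \<in> carrier V \<times> carrier W \<rightarrow> carrier M"
    and add_left: "\<And>v v' w. \<lbrakk>v \<in> carrier V; v' \<in> carrier V; w \<in> carrier W\<rbrakk> \<Longrightarrow>
        h (v \<oplus>\<^bsub>V\<^esub> v', w) \<ominus>\<^bsub>M\<^esub> (h (v, w) \<oplus>\<^bsub>M\<^esub> h (v', w)) \<in> P"
    and add_right: "\<And>v w w'. \<lbrakk>v \<in> carrier V; w \<in> carrier W; w' \<in> carrier W\<rbrakk> \<Longrightarrow>
        h (v, w \<oplus>\<^bsub>W\<^esub> w') \<ominus>\<^bsub>M\<^esub> (h (v, w) \<oplus>\<^bsub>M\<^esub> h (v, w')) \<in> P"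
    and smult_left: "\<And>a v w. \<lbrakk>a \<in> carrier K; v \<in> carrier V; w \<in> carrier W\<rbrakk> \<Longrightarrow>
        h (a \<odot>\<^bsub>V\<^esub> v, w) \<ominus>\<^bsub>M\<^esub> (a \<odot>\<^bsub>M\<^esub> h (v, w)) \<in> P"
    and smult_right: "\<And>a v w. \<lbrakk>a \<in> carrier K; v \<in> carrier V; w \<in> carrier W\<rbrakk> \<Longrightarrow>
        h (v, a \<odot>\<^bsub>W\<^esub> w) \<ominus>\<^bsub>M\<^esub> (a \<odot>\<^bsub>M\<^esub> h (v, w)) \<in> P"
    and f: "f \<in> N"
  shows "free_ext K M (carrier V \<times> carrier W) h f \<in> P"
proof -
  interpret M: module K M by fact
  let ?x = "free_ext K M (carrier V \<times> carrier W) h"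
  have hom: "?x \<in> module_hom K F M"
    using M.free_ext_module_hom[OF h] by (simp add: tensor_free_def)
  interpret X: mod_hom K F M ?x
    by unfold_locales (rule hom)
  have ext_gen: "?x (e v w) = h (v, w)" if "v \<in> carrier V" "w \<in> carrier W" for v w
    unfolding tensor_gen_def by (rule M.free_ext_free_gen[OF _ h]) (use that in simp)
  \<comment> \<open>As \<open>P\<close> is a submodule and \<open>?x\<close> is linear, only the
    four families of relations need checking; \<open>?x\<close> sends each of them to the matching
    expression in \<open>h\<close>.\<close>
  from f tensor_relations_closed show ?thesis unfolding tensor_null_def
  proof (induction rule: F.span_induct)
    case zero
    then show ?case using submodule.zero_closed[OF P] by simp
  next
    case (gen r)
    then show ?case
      by (auto simp: tensor_relations_def Let_def X.f_minus tensor_gen_closed ext_gen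
        add_left add_right smult_left smult_right)
  next
    case (add f g)
    then show ?case using submodule.m_closed[OF P] by simp
  next
    case (smult a f)
    then show ?case using submodule.smult_closed[OF P] by simp
  qed
qed

section \<open>Cosets of the relations and the operations on them\<close>

sublocale N: abelian_subgroup "tensor_null K V W" "tensor_free K V W"
proof (rule abelian_subgroupI3)
  show "additive_subgroup N F"
    unfolding additive_subgroup_def
    using tensor_null_closed tensor_null_zero tensor_null_add tensor_null_minus
    by (auto intro!: subgroup.intro simp: a_inv_def)
qed (rule F.abelian_group_axioms)

lemma null_coset_eq:
  assumes "f \<in> carrier F" "g \<in> carrier F" "f \<ominus>\<^bsub>F\<^esub> g \<in> N"
  shows "N +>\<^bsub>F\<^esub> f = N +>\<^bsub>F\<^esub> g"
proof -
  have "f \<in> N +>\<^bsub>F\<^esub> g"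
    using assms N.a_rcos_module[of g f] by (simp add: a_minus_def)
  then show ?thesis using N.a_repr_independence'[OF _ assms(2)] by simp
qed

lemma null_cosetE:
  assumes "x \<in> N +>\<^bsub>F\<^esub> f" "f \<in> carrier F"
  obtains n where "n \<in> N" "x = n \<oplus>\<^bsub>F\<^esub> f"
  using assms by (auto simp: a_r_coset_def')

lemma null_coset_add_null:
  assumes "n \<in> N" "f \<in> carrier F"
  shows "N +>\<^bsub>F\<^esub> (n \<oplus>\<^bsub>F\<^esub> f) = N +>\<^bsub>F\<^esub> f"
  using assms tensor_null_closed[OF assms(1)]
  by (intro null_coset_eq) (simp_all add: a_minus_def F.a_assoc F.r_neg)

lemma null_coset_self: "f \<in> carrier F \<Longrightarrow> f \<in> N +>\<^bsub>F\<^esub> f"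
  by (rule N.a_rcos_self)

lemma
  shows tensor_product_zero: "\<zero>\<^bsub>tensor_product K V W\<^esub> = N"
    and tensor_product_coset_closed:
      "f \<in> carrier F \<Longrightarrow> N +>\<^bsub>F\<^esub> f \<in> carrier (tensor_product K V W)"
    and tensor_product_add:
      "\<lbrakk>f \<in> carrier F; g \<in> carrier F\<rbrakk> \<Longrightarrow>
        (N +>\<^bsub>F\<^esub> f) \<oplus>\<^bsub>tensor_product K V W\<^esub> (N +>\<^bsub>F\<^esub> g) = N +>\<^bsub>F\<^esub> (f \<oplus>\<^bsub>F\<^esub> g)"
  by (auto simp: tensor_product_def quotient_module_def A_RCOSETS_def' N.a_rcos_sum)

text \<open>Two representatives differ by some \<open>n\<close> in \<open>N\<close>, and their
  multiples by \<open>a n\<close>, which is again in \<open>N\<close>. So all members of the union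
  that defines the scalar multiple are the same coset.\<close>

lemma tensor_product_smult:
  assumes a: "a \<in> carrier K" and f: "f \<in> carrier F"
  shows "a \<odot>\<^bsub>tensor_product K V W\<^esub> (N +>\<^bsub>F\<^esub> f) = N +>\<^bsub>F\<^esub> (a \<odot>\<^bsub>F\<^esub> f)"
proof -
  have "N +>\<^bsub>F\<^esub> (a \<odot>\<^bsub>F\<^esub> x) = N +>\<^bsub>F\<^esub> (a \<odot>\<^bsub>F\<^esub> f)" if "x \<in> N +>\<^bsub>F\<^esub> f" for x
    using that f
  proof (rule null_cosetE)
    fix n assume "n \<in> N" "x = n \<oplus>\<^bsub>F\<^esub> f"
    then show ?thesis
      using a f by (simp add: F.smult_r_distr tensor_null_closed null_coset_add_null tensor_null_smult)
  qed
  then have "(\<Union>x\<in>N +>\<^bsub>F\<^esub> f. N +>\<^bsub>F\<^esub> (a \<odot>\<^bsub>F\<^esub> x)) = N +>\<^bsub>F\<^esub> (a \<odot>\<^bsub>F\<^esub> f)"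
    by (intro UN_constant_eq[OF null_coset_self[OF f]]) auto
  then show ?thesis by (simp add: tensor_product_def quotient_module_def)
qed

end

section \<open>The bracket of the current algebra\<close>

locale current_algebra = L: lie_algebra K L + S: algebra K S
  for K :: "('a, 'k) ring_scheme" (structure)
    and L :: "('a, 'g, 'l) lie_alg_scheme" and S :: "('a, 's, 'n) module_scheme"
begin

sublocale tensor_modules K L S ..

abbreviation "C \<equiv> current_bracket_free K L S"

section \<open>The bracket on the free vector space\<close>

lemma current_gen_fun_closed:
  "p \<in> carrier L \<times> carrier S \<Longrightarrow>
    (\<lambda>q. e (bracket L (fst p) (fst q)) (snd p \<otimes>\<^bsub>S\<^esub> snd q)) \<in> carrier L \<times> carrier S \<rightarrow> carrier F"
  by (auto intro!: tensor_gen_closed L.bracket_closed)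

lemma current_inner_closed:
  "g \<in> carrier F \<Longrightarrow>
    (\<lambda>p. free_ext K F (carrier L \<times> carrier S)
      (\<lambda>q. e (bracket L (fst p) (fst q)) (snd p \<otimes>\<^bsub>S\<^esub> snd q)) g) \<in> carrier L \<times> carrier S \<rightarrow> carrier F"
  by (intro funcsetI F.free_ext_closed[OF _ current_gen_fun_closed]) (simp_all add: tensor_free_def)

text \<open>Pulling \<open>f p\<close> out of the inner sum turns the double sum into an iterated
  linear extension. Bilinearity of the bracket is then inherited from
  \<open>free_ext\<close>.\<close>

lemma current_bracket_free_ext:
  assumes f: "f \<in> carrier F" and g: "g \<in> carrier F"
  shows "C f g = free_ext K F (carrier L \<times> carrier S)
    (\<lambda>p. free_ext K F (carrier L \<times> carrier S)
      (\<lambda>q. e (bracket L (fst p) (fst q)) (snd p \<otimes>\<^bsub>S\<^esub> snd q)) g) f"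
proof -
  let ?I = "carrier L \<times> carrier S"
  let ?E = "\<lambda>p q. e (bracket L (fst p) (fst q)) (snd p \<otimes>\<^bsub>S\<^esub> snd q)"
  have f': "f p \<in> carrier K" and g': "g p \<in> carrier K" if "p \<in> ?I" for p
    using L.R.free_module_coeff_closed[OF f[unfolded tensor_free_def] that]
      L.R.free_module_coeff_closed[OF g[unfolded tensor_free_def] that] by simp_all
  have fin: "finite {q \<in> ?I. g q \<noteq> \<zero>}"
    using g unfolding tensor_free_def by (rule L.R.free_module_finite_support)
  have E: "?E p q \<in> carrier F" if "p \<in> ?I" "q \<in> ?I" for p q
    using that by (auto intro!: tensor_gen_closed L.bracket_closed)
  have inner: "(\<Oplus>\<^bsub>F\<^esub> q\<in>{q \<in> ?I. g q \<noteq> \<zero>}. (f p \<otimes> g q) \<odot>\<^bsub>F\<^esub> ?E p q)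
      = f p \<odot>\<^bsub>F\<^esub> free_ext K F ?I (?E p) g" if p: "p \<in> ?I" for p
  proof -
    have "(\<Oplus>\<^bsub>F\<^esub> q\<in>{q \<in> ?I. g q \<noteq> \<zero>}. (f p \<otimes> g q) \<odot>\<^bsub>F\<^esub> ?E p q)
      = (\<Oplus>\<^bsub>F\<^esub> q\<in>{q \<in> ?I. g q \<noteq> \<zero>}. f p \<odot>\<^bsub>F\<^esub> (g q \<odot>\<^bsub>F\<^esub> ?E p q))"
      by (rule F.finsum_cong') (use p f' g' E in \<open>auto simp: F.smult_assoc1\<close>)
    also have "\<dots> = f p \<odot>\<^bsub>F\<^esub> free_ext K F ?I (?E p) g"
      unfolding free_ext_def
      by (rule F.finsum_smult_ldistr[symmetric]) (use p f' g' E fin in auto)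
    finally show ?thesis .
  qed
  have "C f g = (\<Oplus>\<^bsub>F\<^esub> p\<in>{p \<in> ?I. f p \<noteq> \<zero>}. f p \<odot>\<^bsub>F\<^esub> free_ext K F ?I (?E p) g)"
    unfolding current_bracket_free_def Let_def
    by (rule F.finsum_cong')
      (use inner f' current_inner_closed[OF g] in \<open>auto simp: Pi_def\<close>)
  then show ?thesis by (simp add: free_ext_def)
qed

lemma current_bracket_free_closed:
  assumes "f \<in> carrier F" "g \<in> carrier F"
  shows "C f g \<in> carrier F"
  unfolding current_bracket_free_ext[OF assms]
  using F.free_ext_closed[OF _ current_inner_closed] assms by (simp add: tensor_free_def)

lemma current_bracket_free_add_left:
  assumes "f \<in> carrier F" "f' \<in> carrier F" "g \<in> carrier F"
  shows "C (f \<oplus>\<^bsub>F\<^esub> f') g = C f g \<oplus>\<^bsub>F\<^esub> C f' g"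
  using F.free_ext_add[OF current_inner_closed[OF assms(3)]] assms
  by (simp add: current_bracket_free_ext tensor_free_def[symmetric])

lemma current_bracket_free_smult_left:
  assumes "a \<in> carrier K" "f \<in> carrier F" "g \<in> carrier F"
  shows "C (a \<odot>\<^bsub>F\<^esub> f) g = a \<odot>\<^bsub>F\<^esub> C f g"
  using F.free_ext_smult[OF current_inner_closed[OF assms(3)]] assms
  by (simp add: current_bracket_free_ext tensor_free_def[symmetric])

text \<open>The second argument sits inside the function being extended: the inner extension is
  additive in \<open>g\<close> for each \<open>p\<close>, and the outer one is additive in that
  function.\<close>

lemma current_bracket_free_add_right:
  assumes f: "f \<in> carrier F" and g: "g \<in> carrier F" "g' \<in> carrier F"
  shows "C f (g \<oplus>\<^bsub>F\<^esub> g') = C f g \<oplus>\<^bsub>F\<^esub> C f g'"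
proof -
  let ?I = "carrier L \<times> carrier S"
  let ?H = "\<lambda>g p. free_ext K F ?I (\<lambda>q. e (bracket L (fst p) (fst q)) (snd p \<otimes>\<^bsub>S\<^esub> snd q)) g"
  note [simp] = tensor_free_def[symmetric]
  have "C f (g \<oplus>\<^bsub>F\<^esub> g') = free_ext K F ?I (?H (g \<oplus>\<^bsub>F\<^esub> g')) f"
    using f g by (simp add: current_bracket_free_ext)
  also have "\<dots> = free_ext K F ?I (\<lambda>p. ?H g p \<oplus>\<^bsub>F\<^esub> ?H g' p) f"
  proof (rule F.free_ext_cong)
    show "?H (g \<oplus>\<^bsub>F\<^esub> g') p = ?H g p \<oplus>\<^bsub>F\<^esub> ?H g' p" if "p \<in> ?I" for p
      using F.free_ext_add[OF current_gen_fun_closed[OF that]] g by simp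
    show "(\<lambda>p. ?H g p \<oplus>\<^bsub>F\<^esub> ?H g' p) \<in> ?I \<rightarrow> carrier F"
      using current_inner_closed[OF g(1)] current_inner_closed[OF g(2)] by (simp add: Pi_def)
  qed (use f in simp)
  also have "\<dots> = free_ext K F ?I (?H g) f \<oplus>\<^bsub>F\<^esub> free_ext K F ?I (?H g') f"
    by (rule F.free_ext_add_fun) (use f current_inner_closed g in simp_all)
  finally show ?thesis using f g by (simp add: current_bracket_free_ext)
qed

lemma current_bracket_free_smult_right:
  assumes a: "a \<in> carrier K" and f: "f \<in> carrier F" and g: "g \<in> carrier F"
  shows "C f (a \<odot>\<^bsub>F\<^esub> g) = a \<odot>\<^bsub>F\<^esub> C f g"
proof -
  let ?I = "carrier L \<times> carrier S"
  let ?H = "\<lambda>g p. free_ext K F ?I (\<lambda>q. e (bracket L (fst p) (fst q)) (snd p \<otimes>\<^bsub>S\<^esub> snd q)) g"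
  note [simp] = tensor_free_def[symmetric]
  have "C f (a \<odot>\<^bsub>F\<^esub> g) = free_ext K F ?I (?H (a \<odot>\<^bsub>F\<^esub> g)) f"
    using a f g by (simp add: current_bracket_free_ext)
  also have "\<dots> = free_ext K F ?I (\<lambda>p. a \<odot>\<^bsub>F\<^esub> ?H g p) f"
  proof (rule F.free_ext_cong)
    show "?H (a \<odot>\<^bsub>F\<^esub> g) p = a \<odot>\<^bsub>F\<^esub> ?H g p" if "p \<in> ?I" for p
      using F.free_ext_smult[OF current_gen_fun_closed[OF that]] a g by simp
    show "(\<lambda>p. a \<odot>\<^bsub>F\<^esub> ?H g p) \<in> ?I \<rightarrow> carrier F"
      using a current_inner_closed[OF g] by (simp add: Pi_def)
  qed (use f in simp)
  also have "\<dots> = a \<odot>\<^bsub>F\<^esub> free_ext K F ?I (?H g) f"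
    by (rule F.free_ext_smult_fun) (use a f current_inner_closed g in simp_all)
  finally show ?thesis using f g by (simp add: current_bracket_free_ext)
qed

lemma current_bracket_free_zero_left: "g \<in> carrier F \<Longrightarrow> C \<zero>\<^bsub>F\<^esub> g = \<zero>\<^bsub>F\<^esub>"
  using current_bracket_free_smult_left[of \<zero> "\<zero>\<^bsub>F\<^esub>" g] current_bracket_free_closed by simp

lemma current_bracket_free_zero_right: "f \<in> carrier F \<Longrightarrow> C f \<zero>\<^bsub>F\<^esub> = \<zero>\<^bsub>F\<^esub>"
  using current_bracket_free_smult_right[of \<zero> f "\<zero>\<^bsub>F\<^esub>"] current_bracket_free_closed by simp

text \<open>With a generator in one argument the bracket is a single linear extension, the shape to
  which \<open>free_ext_null\<close> applies.\<close>

lemma current_bracket_free_gen_left: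
  assumes x: "x \<in> carrier L" and s: "s \<in> carrier S" and g: "g \<in> carrier F"
  shows "C (e x s) g = free_ext K F (carrier L \<times> carrier S)
      (\<lambda>q. e (bracket L x (fst q)) (s \<otimes>\<^bsub>S\<^esub> snd q)) g"
  unfolding current_bracket_free_ext[OF tensor_gen_closed[OF x s] g]
  using F.free_ext_free_gen[OF _ current_inner_closed[OF g], of "(x, s)"] x s
  by (simp add: tensor_gen_def)

lemma current_bracket_free_gen_right:
  assumes y: "y \<in> carrier L" and t: "t \<in> carrier S" and f: "f \<in> carrier F"
  shows "C f (e y t) = free_ext K F (carrier L \<times> carrier S)
      (\<lambda>p. e (bracket L (fst p) y) (snd p \<otimes>\<^bsub>S\<^esub> t)) f"
proof -
  have "free_ext K F (carrier L \<times> carrier S)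
      (\<lambda>q. e (bracket L (fst p) (fst q)) (snd p \<otimes>\<^bsub>S\<^esub> snd q)) (e y t)
      = e (bracket L (fst p) y) (snd p \<otimes>\<^bsub>S\<^esub> t)" if "p \<in> carrier L \<times> carrier S" for p
    using F.free_ext_free_gen[OF _ current_gen_fun_closed[OF that], of "(y, t)"] y t
    by (simp add: tensor_gen_def)
  then show ?thesis
    unfolding current_bracket_free_ext[OF f tensor_gen_closed[OF y t]]
    by (intro F.free_ext_cong)
      (use f y t in \<open>auto simp: tensor_free_def[symmetric] intro!: tensor_gen_closed L.bracket_closed\<close>)
qed

lemma current_bracket_free_gen:
  assumes "x \<in> carrier L" "s \<in> carrier S" "y \<in> carrier L" "t \<in> carrier S"
  shows "C (e x s) (e y t) = e (bracket L x y) (s \<otimes>\<^bsub>S\<^esub> t)"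
proof -
  have "(\<lambda>q. e (bracket L x (fst q)) (s \<otimes>\<^bsub>S\<^esub> snd q)) \<in> carrier L \<times> carrier S \<rightarrow> carrier F"
    using current_gen_fun_closed[of "(x, s)"] assms by simp
  from F.free_ext_free_gen[OF _ this, of "(y, t)"] show ?thesis
    unfolding current_bracket_free_gen_left[OF assms(1,2) tensor_gen_closed[OF assms(3,4)]]
    using assms by (simp add: tensor_gen_def)
qed

text \<open>Linearity in \<open>g\<close> reduces to a generator \<open>e y t\<close>. There the
  bracket extends a map that is bilinear modulo \<open>N\<close> in the pair \<open>(x, s)\<close>,
  so \<open>free_ext_null\<close> with \<open>P = N\<close> keeps it in \<open>N\<close>.\<close>

lemma current_bracket_free_null_left:
  assumes f: "f \<in> N" and g: "g \<in> carrier F"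
  shows "C f g \<in> N"
  using g
proof (induction rule: tensor_free_induct)
  case zero
  then show ?case by (simp add: current_bracket_free_zero_right tensor_null_zero tensor_null_closed f)
next
  case (gen y t)
  have sm: "(a \<odot>\<^bsub>S\<^esub> s) \<otimes>\<^bsub>S\<^esub> t = a \<odot>\<^bsub>S\<^esub> (s \<otimes>\<^bsub>S\<^esub> t)" if "a \<in> carrier K" "s \<in> carrier S" for a s
    using that gen S.smult_assoc2 by simp
  show ?case
    unfolding current_bracket_free_gen_right[OF gen tensor_null_closed[OF f]]
    by (rule free_ext_null[OF F.module_axioms tensor_null_submodule _ _ _ _ _ f])
      (use gen in \<open>auto simp: L.bracket_add_left L.bracket_smult_left S.l_distr sm L.bracket_closed
        intro!: tensor_gen_closed tensor_gen_add_left tensor_gen_add_right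
          tensor_gen_smult_left tensor_gen_smult_right\<close>)
next
  case (add g g')
  then show ?case
    using f by (simp add: current_bracket_free_add_right tensor_null_closed tensor_null_add)
next
  case (smult a g)
  then show ?case
    using f by (simp add: current_bracket_free_smult_right tensor_null_closed tensor_null_smult)
qed

lemma current_bracket_free_null_right:
  assumes g: "g \<in> N" and f: "f \<in> carrier F"
  shows "C f g \<in> N"
  using f
proof (induction rule: tensor_free_induct)
  case zero
  then show ?case by (simp add: current_bracket_free_zero_left tensor_null_zero tensor_null_closed g)
next
  case (gen x s)
  \<comment> \<open>Commutativity of \<open>S\<close> carries the scalar rule for the left factor
    over to the right factor.\<close>
  have sm: "s \<otimes>\<^bsub>S\<^esub> (a \<odot>\<^bsub>S\<^esub> t) = a \<odot>\<^bsub>S\<^esub> (s \<otimes>\<^bsub>S\<^esub> t)" if "a \<in> carrier K" "t \<in> carrier S" for a t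
    using that gen S.smult_assoc2[of a t s] by (simp add: S.m_comm)
  show ?case
    unfolding current_bracket_free_gen_left[OF gen tensor_null_closed[OF g]]
    by (rule free_ext_null[OF F.module_axioms tensor_null_submodule _ _ _ _ _ g])
      (use gen in \<open>auto simp: L.bracket_add_right L.bracket_smult_right S.r_distr sm L.bracket_closed
        intro!: tensor_gen_closed tensor_gen_add_left tensor_gen_add_right
          tensor_gen_smult_left tensor_gen_smult_right\<close>)
next
  case (add f f')
  then show ?case
    using g by (simp add: current_bracket_free_add_left tensor_null_closed tensor_null_add)
next
  case (smult a f)
  then show ?case
    using g by (simp add: current_bracket_free_smult_left tensor_null_closed tensor_null_smult)
qed

section \<open>The bracket on cosets\<close>

abbreviation "G \<equiv> current_lie_algebra K L S"

lemma current_lie_algebra_simps: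
  "carrier G = carrier (tensor_product K L S)"
  "\<zero>\<^bsub>G\<^esub> = \<zero>\<^bsub>tensor_product K L S\<^esub>"
  "X \<oplus>\<^bsub>G\<^esub> Y = X \<oplus>\<^bsub>tensor_product K L S\<^esub> Y"
  "a \<odot>\<^bsub>G\<^esub> X = a \<odot>\<^bsub>tensor_product K L S\<^esub> X"
  "bracket G X Y = (\<Union>f\<in>X. \<Union>g\<in>Y. N +>\<^bsub>F\<^esub> C f g)"
  by (simp_all add: current_lie_algebra_def module.defs lie_alg.defs)

text \<open>Replacing \<open>f\<close> and \<open>g\<close> by \<open>n + f\<close> and
  \<open>k + g\<close> with \<open>n\<close>, \<open>k\<close> in \<open>N\<close> changes
  \<open>C f g\<close> by \<open>C n g' + C f k\<close>, and both terms lie in \<open>N\<close>.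
  Hence the double union collapses to one coset.\<close>

lemma current_lie_algebra_bracket:
  assumes f: "f \<in> carrier F" and g: "g \<in> carrier F"
  shows "bracket G (N +>\<^bsub>F\<^esub> f) (N +>\<^bsub>F\<^esub> g) = N +>\<^bsub>F\<^esub> C f g"
proof -
  have *: "N +>\<^bsub>F\<^esub> C f' g' = N +>\<^bsub>F\<^esub> C f g"
    if f': "f' \<in> N +>\<^bsub>F\<^esub> f" and g': "g' \<in> N +>\<^bsub>F\<^esub> g" for f' g'
  proof -
    from f' f obtain n where n: "n \<in> N" "f' = n \<oplus>\<^bsub>F\<^esub> f" by (rule null_cosetE)
    from g' g obtain k where k: "k \<in> N" "g' = k \<oplus>\<^bsub>F\<^esub> g" by (rule null_cosetE)
    have g'F: "g' \<in> carrier F" using k g by (simp add: tensor_null_closed)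
    have "C f' g' = C n g' \<oplus>\<^bsub>F\<^esub> C f g'"
      using n f g'F by (simp add: current_bracket_free_add_left tensor_null_closed)
    also have "C f g' = C f k \<oplus>\<^bsub>F\<^esub> C f g"
      using k f g by (simp add: current_bracket_free_add_right tensor_null_closed)
    finally have "C f' g' = C n g' \<oplus>\<^bsub>F\<^esub> (C f k \<oplus>\<^bsub>F\<^esub> C f g)" .
    moreover have "C n g' \<in> N" "C f k \<in> N"
      using n k f g by (simp_all add: current_bracket_free_null_left current_bracket_free_null_right
        tensor_null_closed)
    ultimately show ?thesis
      using f g by (simp add: null_coset_add_null current_bracket_free_closed tensor_null_closed)
  qed
  \<comment> \<open>The inner union is constant for each \<open>f'\<close>; the outer one is then
    constant as well. Both are nonempty, as a coset contains its representative.\<close>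
  have "(\<Union>g'\<in>N +>\<^bsub>F\<^esub> g. N +>\<^bsub>F\<^esub> C f' g') = N +>\<^bsub>F\<^esub> C f g" if "f' \<in> N +>\<^bsub>F\<^esub> f" for f'
    using that * by (intro UN_constant_eq[OF null_coset_self[OF g]]) auto
  then show ?thesis
    unfolding current_lie_algebra_simps
    by (intro UN_constant_eq[OF null_coset_self[OF f]]) auto
qed

end

section \<open>Algebras generated by a nilpotent element\<close>

text \<open>A polynomial in \<open>s\<close> of degree below \<open>m\<close>. Coefficients are
  indexed by exponents, not by the powers as in \<open>lincomb\<close>, so they can be compared
  before the powers are known to be distinct.\<close>

definition power_comb :: "('a, 's, 'n) module_scheme \<Rightarrow> 's \<Rightarrow> nat \<Rightarrow> (nat \<Rightarrow> 'a) \<Rightarrow> 's"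
  where "power_comb M s m c = (\<Oplus>\<^bsub>M\<^esub> i\<in>{..<m}. c i \<odot>\<^bsub>M\<^esub> s [^]\<^bsub>M\<^esub> i)"

context algebra
begin

lemma power_comb_closed:
  assumes "s \<in> carrier M" "\<And>i. c i \<in> carrier R"
  shows "power_comb M s m c \<in> carrier M"
  unfolding power_comb_def by (rule M.finsum_closed) (use assms in auto)

lemma power_comb_add:
  assumes "s \<in> carrier M" "\<And>i. c i \<in> carrier R" "\<And>i. d i \<in> carrier R"
  shows "power_comb M s m (\<lambda>i. c i \<oplus> d i) = power_comb M s m c \<oplus>\<^bsub>M\<^esub> power_comb M s m d"
  unfolding power_comb_def
  by (subst M.finsum_addf[symmetric])
    (use assms in \<open>auto simp: smult_l_distr intro!: M.finsum_cong'\<close>)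

lemma power_comb_smult:
  assumes "s \<in> carrier M" "\<And>i. c i \<in> carrier R" "a \<in> carrier R"
  shows "power_comb M s m (\<lambda>i. a \<otimes> c i) = a \<odot>\<^bsub>M\<^esub> power_comb M s m c"
  unfolding power_comb_def
  by (subst finsum_smult_ldistr)
    (use assms in \<open>auto simp: smult_assoc1 intro!: M.finsum_cong'\<close>)

text \<open>Multiplying by the complementary power isolates the lowest coefficient.\<close>

lemma power_comb_mult:
  assumes s: "s \<in> carrier M" and nil: "s [^]\<^bsub>M\<^esub> m = \<zero>\<^bsub>M\<^esub>"
    and c: "\<And>i. c i \<in> carrier R" and k: "k < m" and low: "\<And>i. i < k \<Longrightarrow> c i = \<zero>"
  shows "power_comb M s m c \<otimes>\<^bsub>M\<^esub> s [^]\<^bsub>M\<^esub> (m - 1 - k) = c k \<odot>\<^bsub>M\<^esub> s [^]\<^bsub>M\<^esub> (m - 1)"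
proof -
  have "power_comb M s m c \<otimes>\<^bsub>M\<^esub> s [^]\<^bsub>M\<^esub> (m - 1 - k)
      = (\<Oplus>\<^bsub>M\<^esub> i\<in>{..<m}. (c i \<odot>\<^bsub>M\<^esub> s [^]\<^bsub>M\<^esub> i) \<otimes>\<^bsub>M\<^esub> s [^]\<^bsub>M\<^esub> (m - 1 - k))"
    unfolding power_comb_def by (rule finsum_ldistr) (use s c in auto)
  \<comment> \<open>Terms with \<open>i < k\<close> vanish by \<open>low\<close>; those with
    \<open>i > k\<close> have an exponent of at least \<open>m\<close>. Only \<open>i = k\<close>
    survives, with exponent \<open>m - 1\<close>.\<close>
  also have "\<dots> = (\<Oplus>\<^bsub>M\<^esub> i\<in>{..<m}. if k = i then c i \<odot>\<^bsub>M\<^esub> s [^]\<^bsub>M\<^esub> (m - 1) else \<zero>\<^bsub>M\<^esub>)"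
  proof (rule M.finsum_cong')
    fix i assume i: "i \<in> {..<m}"
    have "(c i \<odot>\<^bsub>M\<^esub> s [^]\<^bsub>M\<^esub> i) \<otimes>\<^bsub>M\<^esub> s [^]\<^bsub>M\<^esub> (m - 1 - k) = c i \<odot>\<^bsub>M\<^esub> s [^]\<^bsub>M\<^esub> (i + (m - 1 - k))"
      using s c by (simp add: smult_assoc2 nat_pow_mult)
    also have "\<dots> = (if k = i then c i \<odot>\<^bsub>M\<^esub> s [^]\<^bsub>M\<^esub> (m - 1) else \<zero>\<^bsub>M\<^esub>)"
    proof (cases "k < i")
      case True
      then have "i + (m - 1 - k) = m + (i - 1 - k)" using k by simp
      then have "s [^]\<^bsub>M\<^esub> (i + (m - 1 - k)) = s [^]\<^bsub>M\<^esub> m \<otimes>\<^bsub>M\<^esub> s [^]\<^bsub>M\<^esub> (i - 1 - k)"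
        using s by (simp add: nat_pow_mult)
      then show ?thesis using True s nil c by simp
    next
      case False
      then show ?thesis using k low[of i] s by (cases "k = i") auto
    qed
    finally show "(c i \<odot>\<^bsub>M\<^esub> s [^]\<^bsub>M\<^esub> i) \<otimes>\<^bsub>M\<^esub> s [^]\<^bsub>M\<^esub> (m - 1 - k)
      = (if k = i then c i \<odot>\<^bsub>M\<^esub> s [^]\<^bsub>M\<^esub> (m - 1) else \<zero>\<^bsub>M\<^esub>)" .
  qed (use s c in auto)
  also have "\<dots> = c k \<odot>\<^bsub>M\<^esub> s [^]\<^bsub>M\<^esub> (m - 1)"
    by (rule M.finsum_singleton) (use s c k in auto)
  finally show ?thesis .
qed

end


text \<open>The powers of \<open>s\<close> below \<open>m\<close> are independent and there are
  \<open>dim S\<close> of them, so they form a basis. The functional reads off the coefficient of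
  the top power. Every positive power of \<open>s\<close> annihilates the top power, so
  \<open>t\<close> acts on it through its constant coefficient.\<close>

lemma nilpotent_generator_functional:
  fixes K :: "('a, 'k) ring_scheme" (structure) and S :: "('a, 's, 'n) module_scheme"
  assumes "field K" "algebra K S" "vectorspace.fin_dim K S" and dim: "vectorspace.dim K S = m"
    and s: "s \<in> carrier S" and nil: "s [^]\<^bsub>S\<^esub> m = \<zero>\<^bsub>S\<^esub>" and nz: "s [^]\<^bsub>S\<^esub> (m - 1) \<noteq> \<zero>\<^bsub>S\<^esub>"
  obtains \<phi> where "\<And>t. t \<in> carrier S \<Longrightarrow> \<phi> t \<in> carrier K"
    "\<And>t t'. t \<in> carrier S \<Longrightarrow> t' \<in> carrier S \<Longrightarrow> \<phi> (t \<oplus>\<^bsub>S\<^esub> t') = \<phi> t \<oplus> \<phi> t'"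
    "\<And>a t. a \<in> carrier K \<Longrightarrow> t \<in> carrier S \<Longrightarrow> \<phi> (a \<odot>\<^bsub>S\<^esub> t) = a \<otimes> \<phi> t"
    "\<phi> (s [^]\<^bsub>S\<^esub> (m - 1)) = \<one>"
    "\<And>t. t \<in> carrier S \<Longrightarrow>
      \<exists>c\<in>carrier K. t \<otimes>\<^bsub>S\<^esub> s [^]\<^bsub>S\<^esub> (m - 1) = c \<odot>\<^bsub>S\<^esub> s [^]\<^bsub>S\<^esub> (m - 1)"
proof -
  interpret K: field K by fact
  interpret S: algebra K S by fact
  interpret vectorspace K S by unfold_locales
  let ?u = "s [^]\<^bsub>S\<^esub> (m - 1)"
  have u: "?u \<in> carrier S" using s by simp
  \<comment> \<open>For \<open>m = 0\<close> the truncated difference \<open>m - 1\<close> is also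
    \<open>0\<close>, so \<open>nil\<close> and \<open>nz\<close> would contradict each
    other.\<close>
  have m: "0 < m" using nil nz by (cases m) auto
  \<comment> \<open>Independence by strong induction: once the coefficients below \<open>i\<close>
    vanish, multiplying by the complementary power leaves \<open>c i\<close> times
    \<open>?u\<close>, and \<open>?u\<close> is nonzero.\<close>
  have zero: "\<forall>i<m. c i = \<zero>" if c: "\<And>i. c i \<in> carrier K" and c0: "power_comb S s m c = \<zero>\<^bsub>S\<^esub>" for c
  proof -
    have "i < m \<longrightarrow> c i = \<zero>" for i
    proof (induction i rule: less_induct)
      case (less i)
      show ?case
      proof
        assume i: "i < m"
        have "c i \<odot>\<^bsub>S\<^esub> ?u = \<zero>\<^bsub>S\<^esub> \<otimes>\<^bsub>S\<^esub> s [^]\<^bsub>S\<^esub> (m - 1 - i)"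
          using S.power_comb_mult[where c = c and k = i, OF s nil c i] less i unfolding c0 by simp
        then have *: "c i \<odot>\<^bsub>S\<^esub> ?u = \<zero>\<^bsub>S\<^esub>" using s by simp
        show "c i = \<zero>"
        proof (rule ccontr)
          assume "c i \<noteq> \<zero>"
          then have "?u = inv (c i) \<odot>\<^bsub>S\<^esub> (c i \<odot>\<^bsub>S\<^esub> ?u)"
            using c[of i] u by (simp add: S.smult_assoc1[symmetric] K.field_Units)
          then show False using * nz c[of i] \<open>c i \<noteq> \<zero>\<close> by simp
        qed
      qed
    qed
    then show ?thesis by blast
  qed
  have inj: "\<forall>i<m. c i = d i" if c: "\<And>i. c i \<in> carrier K" and d: "\<And>i. d i \<in> carrier K"
    and eq: "power_comb S s m c = power_comb S s m d" for c d
  proof -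
    have "power_comb S s m (\<lambda>i. c i \<oplus> \<ominus> \<one> \<otimes> d i) = power_comb S s m c \<oplus>\<^bsub>S\<^esub> (\<ominus> \<one>) \<odot>\<^bsub>S\<^esub> power_comb S s m d"
      using c d s by (simp add: S.power_comb_add S.power_comb_smult)
    also have "\<dots> = \<zero>\<^bsub>S\<^esub>"
      unfolding eq using S.power_comb_closed[of s d] d s by (simp add: S.smult_minus_1 S.M.r_neg)
    finally have "\<forall>i<m. c i \<oplus> \<ominus> \<one> \<otimes> d i = \<zero>" by (intro zero) (use c d in simp_all)
    moreover have "c i = d i" if "c i \<oplus> \<ominus> \<one> \<otimes> d i = \<zero>" for i
      using that c[of i] d[of i] by (simp add: K.l_minus a_minus_def[symmetric])
    ultimately show ?thesis by blast
  qed
  let ?p = "\<lambda>i. s [^]\<^bsub>S\<^esub> i"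
  let ?A = "?p ` {..<m}"
  \<comment> \<open>The coefficient sequence of the power with exponent \<open>i\<close>; uniqueness
    of coefficients then separates the powers.\<close>
  define \<delta> where "\<delta> = (\<lambda>i j::nat. if i = j then \<one> else \<zero>)"
  have \<delta>: "power_comb S s m (\<delta> i) = ?p i" if "i < m" for i
  proof -
    have "power_comb S s m (\<delta> i) = (\<Oplus>\<^bsub>S\<^esub> j\<in>{..<m}. if i = j then ?p j else \<zero>\<^bsub>S\<^esub>)"
      unfolding power_comb_def \<delta>_def by (rule S.M.finsum_cong') (use s in auto)
    also have "\<dots> = ?p i" by (rule S.M.finsum_singleton) (use s that in auto)
    finally show ?thesis .
  qed
  have power_inj: "inj_on ?p {..<m}"
  proof (rule inj_onI)
    fix i j assume ij: "i \<in> {..<m}" "j \<in> {..<m}" "?p i = ?p j"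
    then have "\<forall>k<m. \<delta> i k = \<delta> j k"
      using \<delta> by (intro inj) (auto simp: \<delta>_def)
    then show "i = j" using ij by (auto simp: \<delta>_def split: if_splits)
  qed
  have A: "?A \<subseteq> carrier S" using s by auto
  \<comment> \<open>Translation between combinations over the set of powers and coefficient
    sequences. The sequence is padded with zero from \<open>m\<close> on, because
    \<open>zero\<close> and \<open>inj\<close> require every coefficient to lie in the
    field.\<close>
  have lincomb_eq: "S.lincomb a ?A = power_comb S s m (\<lambda>i. if i < m then a (?p i) else \<zero>)"
    if a: "a \<in> ?A \<rightarrow> carrier K" for a
  proof -
    have a': "a (?p i) \<in> carrier K" if "i < m" for i using a that by blast
    have "S.lincomb a ?A = (\<Oplus>\<^bsub>S\<^esub> i\<in>{..<m}. a (?p i) \<odot>\<^bsub>S\<^esub> ?p i)"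
      unfolding S.lincomb_def by (rule S.M.finsum_reindex) (use power_inj a' s in auto)
    also have "\<dots> = power_comb S s m (\<lambda>i. if i < m then a (?p i) else \<zero>)"
      unfolding power_comb_def by (rule S.M.finsum_cong') (use a' s in auto)
    finally show ?thesis .
  qed
  have li: "S.lin_indpt ?A"
  proof (rule S.finite_lin_indpt2)
    fix a assume a: "a \<in> ?A \<rightarrow> carrier K" and "S.lincomb a ?A = \<zero>\<^bsub>S\<^esub>"
    then have "\<forall>i<m. (if i < m then a (?p i) else \<zero>) = \<zero>"
      using a by (intro zero) (auto simp: lincomb_eq)
    then show "\<forall>v\<in>?A. a v = \<zero>" by auto
  qed (use A in auto)
  have "basis ?A"
    by (rule dim_li_is_basis) (use assms li A card_image[OF power_inj] in auto)
  then have "t \<in> S.span ?A" if "t \<in> carrier S" for t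
    using that by (simp add: basis_def)
  then have *: "\<exists>a. a \<in> ?A \<rightarrow> carrier K \<and> S.lincomb a ?A = t" if "t \<in> carrier S" for t
    using S.finite_in_span[OF _ A, of t] that by auto
  have "\<exists>c. (\<forall>i. c i \<in> carrier K) \<and> power_comb S s m c = t" if t: "t \<in> carrier S" for t
  proof -
    obtain a where a: "a \<in> ?A \<rightarrow> carrier K" "S.lincomb a ?A = t" using *[OF t] by blast
    show ?thesis
      by (rule exI[of _ "\<lambda>i. if i < m then a (?p i) else \<zero>"]) (use a lincomb_eq[OF a(1)] in auto)
  qed
  \<comment> \<open>The choice of \<open>c t\<close> is determined only below \<open>m\<close>. By
    \<open>inj\<close> those coefficients depend linearly on \<open>t\<close>, and \<phi> is the
    coefficient at \<open>m - 1\<close>.\<close>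
  then obtain c where c: "\<And>t i. t \<in> carrier S \<Longrightarrow> c t i \<in> carrier K"
    "\<And>t. t \<in> carrier S \<Longrightarrow> power_comb S s m (c t) = t"
    by metis
  show thesis
  proof
    show "c t (m - 1) \<in> carrier K" if "t \<in> carrier S" for t using c that by blast
    show "c (t \<oplus>\<^bsub>S\<^esub> t') (m - 1) = c t (m - 1) \<oplus> c t' (m - 1)"
      if t: "t \<in> carrier S" "t' \<in> carrier S" for t t'
    proof -
      have "\<forall>i<m. c (t \<oplus>\<^bsub>S\<^esub> t') i = c t i \<oplus> c t' i"
        by (rule inj) (use t c s in \<open>auto simp: S.power_comb_add\<close>)
      then show ?thesis using m by simp
    qed
    show "c (a \<odot>\<^bsub>S\<^esub> t) (m - 1) = a \<otimes> c t (m - 1)"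
      if t: "a \<in> carrier K" "t \<in> carrier S" for a t
    proof -
      have "\<forall>i<m. c (a \<odot>\<^bsub>S\<^esub> t) i = a \<otimes> c t i"
        by (rule inj) (use t c s in \<open>auto simp: S.power_comb_smult\<close>)
      then show ?thesis using m by simp
    qed
    have "\<forall>i<m. c ?u i = \<delta> (m - 1) i"
      by (rule inj) (use u c \<delta>[of "m - 1"] m in \<open>auto simp: \<delta>_def\<close>)
    then show "c ?u (m - 1) = \<one>" using m by (simp add: \<delta>_def)
    \<comment> \<open>The case \<open>k = 0\<close> of \<open>power_comb_mult\<close>: the scalar is
      the constant coefficient of \<open>t\<close>.\<close>
    show "\<exists>a\<in>carrier K. t \<otimes>\<^bsub>S\<^esub> ?u = a \<odot>\<^bsub>S\<^esub> ?u" if t: "t \<in> carrier S" for t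
      using S.power_comb_mult[where c = "c t", OF s nil c(1)[OF t] m] c[OF t] by auto
  qed
qed

section \<open>Descent of the metric\<close>

locale current_metric = current_algebra K L S
  for K :: "('a, 'k) ring_scheme" (structure)
    and L :: "('a, 'g, 'l) lie_alg_scheme" and S :: "('a, 's, 'n) module_scheme" +
  fixes Bbar :: "('g \<times> 's \<Rightarrow> 'a) set \<Rightarrow> ('g \<times> 's \<Rightarrow> 'a) set \<Rightarrow> 'a"
  assumes metric: "invariant_metric K (current_lie_algebra K L S) Bbar"
begin

section \<open>The metric pulled back to the free vector space\<close>

definition lifted_form :: "('g \<times> 's \<Rightarrow> 'a) \<Rightarrow> ('g \<times> 's \<Rightarrow> 'a) \<Rightarrow> 'a"
  where "lifted_form f g = Bbar (N +>\<^bsub>F\<^esub> f) (N +>\<^bsub>F\<^esub> g)"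

lemma metric_form: "bilinear_form K G Bbar"
  using metric by (simp add: invariant_metric_def)

lemma coset_closed: "f \<in> carrier F \<Longrightarrow> N +>\<^bsub>F\<^esub> f \<in> carrier G"
  by (simp add: current_lie_algebra_simps tensor_product_coset_closed)

lemma lifted_form_closed:
  "\<lbrakk>f \<in> carrier F; g \<in> carrier F\<rbrakk> \<Longrightarrow> lifted_form f g \<in> carrier K"
  using metric_form coset_closed by (auto simp: bilinear_form_def lifted_form_def)

lemma lifted_form_add_left:
  assumes "f \<in> carrier F" "f' \<in> carrier F" "g \<in> carrier F"
  shows "lifted_form (f \<oplus>\<^bsub>F\<^esub> f') g = lifted_form f g \<oplus> lifted_form f' g"
proof -
  have "Bbar ((N +>\<^bsub>F\<^esub> f) \<oplus>\<^bsub>G\<^esub> (N +>\<^bsub>F\<^esub> f')) (N +>\<^bsub>F\<^esub> g)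
      = Bbar (N +>\<^bsub>F\<^esub> f) (N +>\<^bsub>F\<^esub> g) \<oplus> Bbar (N +>\<^bsub>F\<^esub> f') (N +>\<^bsub>F\<^esub> g)"
    using metric_form assms[THEN coset_closed] unfolding bilinear_form_def by blast
  then show ?thesis
    using assms by (simp add: lifted_form_def current_lie_algebra_simps tensor_product_add)
qed

lemma lifted_form_smult_left:
  assumes "a \<in> carrier K" and fg: "f \<in> carrier F" "g \<in> carrier F"
  shows "lifted_form (a \<odot>\<^bsub>F\<^esub> f) g = a \<otimes> lifted_form f g"
proof -
  have "Bbar (a \<odot>\<^bsub>G\<^esub> (N +>\<^bsub>F\<^esub> f)) (N +>\<^bsub>F\<^esub> g) = a \<otimes> Bbar (N +>\<^bsub>F\<^esub> f) (N +>\<^bsub>F\<^esub> g)"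
    using metric_form assms(1) fg[THEN coset_closed] unfolding bilinear_form_def by blast
  then show ?thesis
    using assms by (simp add: lifted_form_def current_lie_algebra_simps tensor_product_smult)
qed

lemma lifted_form_sym:
  "\<lbrakk>f \<in> carrier F; g \<in> carrier F\<rbrakk> \<Longrightarrow> lifted_form f g = lifted_form g f"
  using metric coset_closed by (auto simp: invariant_metric_def lifted_form_def)

lemma lifted_form_add_right:
  assumes "f \<in> carrier F" "g \<in> carrier F" "g' \<in> carrier F"
  shows "lifted_form f (g \<oplus>\<^bsub>F\<^esub> g') = lifted_form f g \<oplus> lifted_form f g'"
  using assms lifted_form_add_left[of g g' f] by (simp add: lifted_form_sym[of f])

lemma lifted_form_smult_right:
  assumes "a \<in> carrier K" "f \<in> carrier F" "g \<in> carrier F"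
  shows "lifted_form f (a \<odot>\<^bsub>F\<^esub> g) = a \<otimes> lifted_form f g"
  using assms lifted_form_smult_left[of a g f] by (simp add: lifted_form_sym[of f])

lemma lifted_form_invariant:
  assumes fgh: "f \<in> carrier F" "g \<in> carrier F" "h \<in> carrier F"
  shows "lifted_form f (C g h) = lifted_form (C f g) h"
proof -
  have "Bbar (N +>\<^bsub>F\<^esub> f) (bracket G (N +>\<^bsub>F\<^esub> g) (N +>\<^bsub>F\<^esub> h))
      = Bbar (bracket G (N +>\<^bsub>F\<^esub> f) (N +>\<^bsub>F\<^esub> g)) (N +>\<^bsub>F\<^esub> h)"
    using metric fgh[THEN coset_closed] unfolding invariant_metric_def by blast
  then show ?thesis
    using fgh by (simp add: lifted_form_def current_lie_algebra_bracket)
qed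

text \<open>Every element of the current algebra is a coset of some \<open>g\<close>, so the coset
  of \<open>f\<close> lies in the radical of \<open>Bbar\<close> and must be the zero coset
  \<open>N\<close>.\<close>

lemma lifted_form_radical:
  assumes f: "f \<in> carrier F" and 0: "\<And>g. g \<in> carrier F \<Longrightarrow> lifted_form f g = \<zero>"
  shows "f \<in> N"
proof -
  have "\<forall>Y\<in>carrier G. Bbar (N +>\<^bsub>F\<^esub> f) Y = \<zero>"
    using 0 by (auto simp: current_lie_algebra_simps tensor_product_def quotient_module_def
      A_RCOSETS_def' lifted_form_def)
  then have "N +>\<^bsub>F\<^esub> f = \<zero>\<^bsub>G\<^esub>"
    using metric coset_closed[OF f] unfolding invariant_metric_def by blast
  then show ?thesis
    using null_coset_self[OF f] by (simp add: current_lie_algebra_simps tensor_product_zero)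
qed

text \<open>The form sees only cosets, so the relations of the tensor product become equalities
  inside it. This gives linearity in each factor of a pure tensor.\<close>

lemma lifted_form_cong_left:
  assumes "f \<in> carrier F" "f' \<in> carrier F" "f \<ominus>\<^bsub>F\<^esub> f' \<in> N"
  shows "lifted_form f g = lifted_form f' g"
  by (simp add: lifted_form_def null_coset_eq[OF assms])

section \<open>The metric on pure tensors\<close>

definition gen_form :: "'g \<Rightarrow> 's \<Rightarrow> 'g \<Rightarrow> 's \<Rightarrow> 'a"
  where "gen_form x s y t = lifted_form (e x s) (e y t)"

lemma gen_form_closed:
  "\<lbrakk>x \<in> carrier L; s \<in> carrier S; y \<in> carrier L; t \<in> carrier S\<rbrakk> \<Longrightarrow> gen_form x s y t \<in> carrier K"
  by (simp add: gen_form_def lifted_form_closed tensor_gen_closed)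

lemma gen_form_sym:
  "\<lbrakk>x \<in> carrier L; s \<in> carrier S; y \<in> carrier L; t \<in> carrier S\<rbrakk> \<Longrightarrow>
    gen_form x s y t = gen_form y t x s"
  by (simp add: gen_form_def lifted_form_sym tensor_gen_closed)

lemma gen_form_add_left:
  assumes "x \<in> carrier L" "x' \<in> carrier L" "s \<in> carrier S" "y \<in> carrier L" "t \<in> carrier S"
  shows "gen_form (x \<oplus>\<^bsub>L\<^esub> x') s y t = gen_form x s y t \<oplus> gen_form x' s y t"
proof -
  have "gen_form (x \<oplus>\<^bsub>L\<^esub> x') s y t = lifted_form (e x s \<oplus>\<^bsub>F\<^esub> e x' s) (e y t)"
    unfolding gen_form_def
    by (rule lifted_form_cong_left) (use assms in \<open>simp_all add: tensor_gen_closed tensor_gen_add_left\<close>)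
  then show ?thesis
    using assms by (simp add: gen_form_def lifted_form_add_left tensor_gen_closed)
qed

lemma gen_form_smult_left:
  assumes "a \<in> carrier K" "x \<in> carrier L" "s \<in> carrier S" "y \<in> carrier L" "t \<in> carrier S"
  shows "gen_form (a \<odot>\<^bsub>L\<^esub> x) s y t = a \<otimes> gen_form x s y t"
proof -
  have "gen_form (a \<odot>\<^bsub>L\<^esub> x) s y t = lifted_form (a \<odot>\<^bsub>F\<^esub> e x s) (e y t)"
    unfolding gen_form_def
    by (rule lifted_form_cong_left) (use assms in \<open>simp_all add: tensor_gen_closed tensor_gen_smult_left\<close>)
  then show ?thesis
    using assms by (simp add: gen_form_def lifted_form_smult_left tensor_gen_closed)
qed

lemma gen_form_smult_scalar:
  assumes "a \<in> carrier K" "x \<in> carrier L" "s \<in> carrier S" "y \<in> carrier L" "t \<in> carrier S"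
  shows "gen_form x (a \<odot>\<^bsub>S\<^esub> s) y t = a \<otimes> gen_form x s y t"
proof -
  have "gen_form x (a \<odot>\<^bsub>S\<^esub> s) y t = lifted_form (a \<odot>\<^bsub>F\<^esub> e x s) (e y t)"
    unfolding gen_form_def
    by (rule lifted_form_cong_left) (use assms in \<open>simp_all add: tensor_gen_closed tensor_gen_smult_right\<close>)
  then show ?thesis
    using assms by (simp add: gen_form_def lifted_form_smult_left tensor_gen_closed)
qed

lemma gen_form_invariant:
  assumes "x \<in> carrier L" "y \<in> carrier L" "z \<in> carrier L"
    "r \<in> carrier S" "s \<in> carrier S" "t \<in> carrier S"
  shows "gen_form x r (bracket L y z) (s \<otimes>\<^bsub>S\<^esub> t) = gen_form (bracket L x y) (r \<otimes>\<^bsub>S\<^esub> s) z t"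
  using lifted_form_invariant[of "e x r" "e y s" "e z t"] assms
  by (simp add: gen_form_def tensor_gen_closed current_bracket_free_gen)

text \<open>On brackets this is invariance with \<open>s\<close> attached to the middle factor; perfectness of \<open>L\<close>
  then gives it everywhere.\<close>

lemma gen_form_shift:
  assumes perfect: "derived_algebra K L = carrier L"
    and x: "x \<in> carrier L" and y: "y \<in> carrier L" and s: "s \<in> carrier S" and t: "t \<in> carrier S"
  shows "gen_form x s y t = gen_form x \<one>\<^bsub>S\<^esub> y (s \<otimes>\<^bsub>S\<^esub> t)"
proof -
  let ?A = "{bracket L x y | x y. x \<in> carrier L \<and> y \<in> carrier L}"
  have A: "?A \<subseteq> carrier L" using L.bracket_closed by auto
  have "x \<in> L.span ?A" using x perfect by (simp add: derived_algebra_def)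
  then show ?thesis using A
  proof (induction rule: L.span_induct)
    case zero
    have "gen_form \<zero>\<^bsub>L\<^esub> s' y t' = \<zero>" if "s' \<in> carrier S" "t' \<in> carrier S" for s' t'
      using gen_form_smult_left[of \<zero> "\<zero>\<^bsub>L\<^esub>" s' y t'] gen_form_closed[of "\<zero>\<^bsub>L\<^esub>" s' y t'] y that
      by simp
    then show ?case using s t by simp
  next
    case (gen x)
    then obtain u v where uv: "u \<in> carrier L" "v \<in> carrier L" "x = bracket L u v" by auto
    \<comment> \<open>Invariance is used twice, with the middle tensor carrying first
      \<open>s\<close> and then the unit; both sides meet in the same value.\<close>
    have "gen_form x s y t = gen_form u \<one>\<^bsub>S\<^esub> (bracket L v y) (s \<otimes>\<^bsub>S\<^esub> t)"
      using gen_form_invariant[of u v y "\<one>\<^bsub>S\<^esub>" s t] uv y s t by simp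
    also have "\<dots> = gen_form x \<one>\<^bsub>S\<^esub> y (s \<otimes>\<^bsub>S\<^esub> t)"
      using gen_form_invariant[of u v y "\<one>\<^bsub>S\<^esub>" "\<one>\<^bsub>S\<^esub>" "s \<otimes>\<^bsub>S\<^esub> t"] uv y s t by simp
    finally show ?case .
  next
    case (add x x')
    then show ?case using y s t by (simp add: gen_form_add_left)
  next
    case (smult a x)
    then show ?case using y s t by (simp add: gen_form_smult_left)
  qed
qed

text \<open>The element \<open>u\<close> enters through two properties: some functional takes the
  value one on it, and its multiples in \<open>S\<close> are scalar multiples. The first recovers
  \<open>x\<close> from the tensor of \<open>x\<close> and \<open>u\<close>; the second reduces
  orthogonality to \<open>?B\<close>.\<close>

lemma invariant_metric_descent:
  assumes perfect: "derived_algebra K L = carrier L" and u: "u \<in> carrier S"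
    and \<phi>: "\<And>t. t \<in> carrier S \<Longrightarrow> \<phi> t \<in> carrier K"
      "\<And>t t'. t \<in> carrier S \<Longrightarrow> t' \<in> carrier S \<Longrightarrow> \<phi> (t \<oplus>\<^bsub>S\<^esub> t') = \<phi> t \<oplus> \<phi> t'"
      "\<And>a t. a \<in> carrier K \<Longrightarrow> t \<in> carrier S \<Longrightarrow> \<phi> (a \<odot>\<^bsub>S\<^esub> t) = a \<otimes> \<phi> t"
      "\<phi> u = \<one>"
    and socle: "\<And>t. t \<in> carrier S \<Longrightarrow> \<exists>c\<in>carrier K. t \<otimes>\<^bsub>S\<^esub> u = c \<odot>\<^bsub>S\<^esub> u"
  shows "invariant_metric K L (\<lambda>x y. gen_form x \<one>\<^bsub>S\<^esub> y u)"
proof -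
  let ?B = "\<lambda>x y. gen_form x \<one>\<^bsub>S\<^esub> y u"
  have shift: "gen_form x u y t = gen_form x \<one>\<^bsub>S\<^esub> y (u \<otimes>\<^bsub>S\<^esub> t)"
    if "x \<in> carrier L" "y \<in> carrier L" "t \<in> carrier S" for x y t
    by (rule gen_form_shift[OF perfect that(1,2) u that(3)])
  \<comment> \<open>Shifting \<open>u\<close> to the first tensor leaves the unit in the second, so
    the symmetry of \<open>Bbar\<close> exchanges the two roles.\<close>
  have sym: "?B x y = ?B y x" if "x \<in> carrier L" "y \<in> carrier L" for x y
  proof -
    have "?B x y = gen_form x u y \<one>\<^bsub>S\<^esub>" using shift[of x y "\<one>\<^bsub>S\<^esub>"] that u by simp
    also have "\<dots> = ?B y x" using gen_form_sym that u by simp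
    finally show ?thesis .
  qed
  have add: "?B (x \<oplus>\<^bsub>L\<^esub> y) z = ?B x z \<oplus> ?B y z"
    if "x \<in> carrier L" "y \<in> carrier L" "z \<in> carrier L" for x y z
    using that u by (simp add: gen_form_add_left)
  have smult: "?B (a \<odot>\<^bsub>L\<^esub> x) y = a \<otimes> ?B x y"
    if "a \<in> carrier K" "x \<in> carrier L" "y \<in> carrier L" for a x y
    using that u by (simp add: gen_form_smult_left)
  have inv: "?B x (bracket L y z) = ?B (bracket L x y) z"
    if "x \<in> carrier L" "y \<in> carrier L" "z \<in> carrier L" for x y z
    using gen_form_invariant[of x y z "\<one>\<^bsub>S\<^esub>" "\<one>\<^bsub>S\<^esub>" u] that u by simp
  have nondeg: "x = \<zero>\<^bsub>L\<^esub>" if x: "x \<in> carrier L" and 0: "\<And>y. y \<in> carrier L \<Longrightarrow> ?B x y = \<zero>" for x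
  proof -
    \<comment> \<open>The tensor of \<open>x\<close> and \<open>u\<close> is orthogonal to every
      pure tensor: the shift puts \<open>u t = c u\<close> into the second slot, which gives
      \<open>c\<close> times \<open>?B x y\<close>.\<close>
    have "gen_form x u y t = \<zero>" if y: "y \<in> carrier L" and t: "t \<in> carrier S" for y t
    proof -
      obtain c where c: "c \<in> carrier K" "t \<otimes>\<^bsub>S\<^esub> u = c \<odot>\<^bsub>S\<^esub> u" using socle[OF t] by blast
      have "gen_form x u y t = gen_form x \<one>\<^bsub>S\<^esub> y (c \<odot>\<^bsub>S\<^esub> u)"
        using shift[OF x y t] c(2) S.m_comm[OF u t] by simp
      \<comment> \<open>The arguments are swapped because \<open>gen_form_smult_scalar\<close>
        extracts scalars from the first tensor.\<close>
      also have "\<dots> = gen_form y (c \<odot>\<^bsub>S\<^esub> u) x \<one>\<^bsub>S\<^esub>"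
        using x y c u by (intro gen_form_sym) simp_all
      also have "\<dots> = c \<otimes> gen_form x \<one>\<^bsub>S\<^esub> y u"
        using x y c u by (simp add: gen_form_smult_scalar gen_form_sym[of x])
      also have "\<dots> = \<zero>" using 0[OF y] c by simp
      finally show ?thesis .
    qed
    note gen0 = this
    have "lifted_form (e x u) g = \<zero>" if "g \<in> carrier F" for g
      using that
    proof (induction rule: tensor_free_induct)
      case zero
      show ?case
        using lifted_form_smult_right[of \<zero> "e x u" "\<zero>\<^bsub>F\<^esub>"] lifted_form_closed[of "e x u" "\<zero>\<^bsub>F\<^esub>"]
          tensor_gen_closed[OF x u] by simp
    next
      case (gen y t)
      then show ?case using gen0 by (simp add: gen_form_def)
    next
      case (add f g)
      then show ?case using tensor_gen_closed[OF x u] by (simp add: lifted_form_add_right)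
    next
      case (smult a f)
      then show ?case using tensor_gen_closed[OF x u] by (simp add: lifted_form_smult_right)
    qed
    then have null: "e x u \<in> N" by (rule lifted_form_radical[OF tensor_gen_closed[OF x u]])
    \<comment> \<open>This induces the map identity tensor \<phi> from the tensor product to
      \<open>L\<close>. It respects the relations exactly, hence \<open>P\<close> is the zero
      submodule below. It kills the null element \<open>e x u\<close>, yet sends it to
      \<open>\<phi> u\<close> times \<open>x\<close>, which is \<open>x\<close>.\<close>
    let ?h = "\<lambda>p. \<phi> (snd p) \<odot>\<^bsub>L\<^esub> fst p"
    have h: "?h \<in> carrier L \<times> carrier S \<rightarrow> carrier L" using \<phi>(1) by auto
    have "submodule K {\<zero>\<^bsub>L\<^esub>} L"
      by (rule submodule_by_closure[OF L.module_axioms]) auto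
    then have "free_ext K L (carrier L \<times> carrier S) ?h (e x u) \<in> {\<zero>\<^bsub>L\<^esub>}"
    proof (rule free_ext_null[OF L.module_axioms _ h _ _ _ _ null])
      show "?h (v \<oplus>\<^bsub>L\<^esub> v', w) \<ominus>\<^bsub>L\<^esub> (?h (v, w) \<oplus>\<^bsub>L\<^esub> ?h (v', w)) \<in> {\<zero>\<^bsub>L\<^esub>}"
        if "v \<in> carrier L" "v' \<in> carrier L" "w \<in> carrier S" for v v' w
        using that \<phi>(1) by (simp add: L.smult_r_distr)
      show "?h (v, w \<oplus>\<^bsub>S\<^esub> w') \<ominus>\<^bsub>L\<^esub> (?h (v, w) \<oplus>\<^bsub>L\<^esub> ?h (v, w')) \<in> {\<zero>\<^bsub>L\<^esub>}"
        if "v \<in> carrier L" "w \<in> carrier S" "w' \<in> carrier S" for v w w'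
        using that \<phi>(1) by (simp add: L.smult_l_distr \<phi>(2))
      show "?h (a \<odot>\<^bsub>L\<^esub> v, w) \<ominus>\<^bsub>L\<^esub> (a \<odot>\<^bsub>L\<^esub> ?h (v, w)) \<in> {\<zero>\<^bsub>L\<^esub>}"
        if "a \<in> carrier K" "v \<in> carrier L" "w \<in> carrier S" for a v w
        using that \<phi>(1) by (simp add: L.smult_assoc1[symmetric] L.R.m_comm)
      show "?h (v, a \<odot>\<^bsub>S\<^esub> w) \<ominus>\<^bsub>L\<^esub> (a \<odot>\<^bsub>L\<^esub> ?h (v, w)) \<in> {\<zero>\<^bsub>L\<^esub>}"
        if "a \<in> carrier K" "v \<in> carrier L" "w \<in> carrier S" for a v w
        using that \<phi>(1) by (simp add: L.smult_assoc1 \<phi>(3))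
    qed
    moreover have "free_ext K L (carrier L \<times> carrier S) ?h (e x u) = x"
      unfolding tensor_gen_def
      using L.free_ext_free_gen[OF _ h, of "(x, u)"] x u \<phi>(4) by simp
    ultimately show ?thesis by simp
  qed
  have "bilinear_form K L ?B"
    unfolding bilinear_form_def
  proof (intro conjI ballI)
    show "?B x y \<in> carrier K" if "x \<in> carrier L" "y \<in> carrier L" for x y
      using that u by (simp add: gen_form_closed)
    show "?B (x \<oplus>\<^bsub>L\<^esub> y) z = ?B x z \<oplus> ?B y z"
      if "x \<in> carrier L" "y \<in> carrier L" "z \<in> carrier L" for x y z
      using add[OF that] .
    show "?B x (y \<oplus>\<^bsub>L\<^esub> z) = ?B x y \<oplus> ?B x z"
      if "x \<in> carrier L" "y \<in> carrier L" "z \<in> carrier L" for x y z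
      using add[of y z x] sym[of x] that by simp
    show "?B (a \<odot>\<^bsub>L\<^esub> x) y = a \<otimes> ?B x y"
      if "a \<in> carrier K" "x \<in> carrier L" "y \<in> carrier L" for a x y
      using smult[OF that] .
    show "?B x (a \<odot>\<^bsub>L\<^esub> y) = a \<otimes> ?B x y"
      if "a \<in> carrier K" "x \<in> carrier L" "y \<in> carrier L" for a x y
      using smult[of a y x] sym[of x] that by simp
  qed
  then show ?thesis
    unfolding invariant_metric_def using sym inv by (intro conjI ballI impI nondeg) simp_all
qed

end

theorem proposition3p3:
  fixes K :: "('a, 'k) ring_scheme"
    and L :: "('a, 'g, 'l) lie_alg_scheme"
    and S :: "('a, 's, 'n) module_scheme"
    and s :: 's and m :: nat
    and Bbar :: "('g \<times> 's \<Rightarrow> 'a) set \<Rightarrow> ('g \<times> 's \<Rightarrow> 'a) set \<Rightarrow> 'a"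
  assumes "field K"
    and char_zero: "\<And>n::nat. n > 0 \<Longrightarrow> [n] \<cdot>\<^bsub>K\<^esub> \<one>\<^bsub>K\<^esub> \<noteq> \<zero>\<^bsub>K\<^esub>"
    and "lie_algebra K L" and "vectorspace.fin_dim K L"
    and perfect: "derived_algebra K L = carrier L"
    and "algebra K S" and "vectorspace.fin_dim K S" and "vectorspace.dim K S = m"
    and "s \<in> carrier S" and "s \<noteq> \<zero>\<^bsub>S\<^esub>"
    and "s [^]\<^bsub>S\<^esub> m = \<zero>\<^bsub>S\<^esub>" and "s [^]\<^bsub>S\<^esub> (m - 1) \<noteq> \<zero>\<^bsub>S\<^esub>"
    and "invariant_metric K (current_lie_algebra K L S) Bbar"
  shows "\<exists>B. invariant_metric K L B"
proof -
  interpret S: algebra K S by fact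
  have "current_metric K L S Bbar"
    using assms by (simp add: current_metric_def current_algebra_def current_metric_axioms_def)
  then interpret current_metric K L S Bbar .
  show ?thesis
  \<comment> \<open>The powers of \<open>s\<close> supply the functional and the scalar action; the
    metric is then formed with \<open>u\<close> equal to the power of exponent
    \<open>m - 1\<close>.\<close>
  proof (rule nilpotent_generator_functional[OF assms(1,6-9,11,12)], goal_cases)
    case (1 \<phi>)
    show ?case
      by (rule exI, rule invariant_metric_descent[where \<phi> = \<phi>,
          OF perfect S.nat_pow_closed[OF \<open>s \<in> carrier S\<close>]]) (fact 1)+
  qed
qed

end
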